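(* Let $n\ge 2$ be a fixed integer. There are constants $C_n,C_n'>0$ depending only on $n$ such that for all real $X\ge 3$ and $M>0$, $$\#\bigcup_{\substack{\varsigma>M\\ \varsigma\ \text{squarefree}}}\{f\in\mathcal{W}^{(1)}_{\varsigma}: H(f)\le X\}\ \le\ C_n\left(\frac{X^{\frac{n(n+1)}{2}+\frac{C_n'}{\log\log X}}}{M}+X^{\frac{n(n+1)}{2}+\frac{C_n'}{\log\log X}-(n-1)}\right).$$
   Context: For a monic polynomial $f=x^n+a_1x^{n-1}+\cdots+a_n\in\mathbb{Z}[x]$, the height is $H(f)=\max_{1\le i\le n}|a_i|^{1/i}$, so that $H(f)\le X$ means $|a_i|\le X^i$ for all $i$. For a prime $p$, the discriminant of $f$ is said to be strongly divisible by $p^2$ if $p^2\mid \mathrm{disc}(f+pg)$ for every $g\in\mathbb{Z}[x]$ of degree at most $n-1$. For a positive squarefree integer $\varsigma$, $\mathcal{W}^{(1)}_{\varsigma}$ denotes the set of monic integer polynomials of degree $n$ whose discriminant is strongly divisible by $p^2$ for every prime $p\mid\varsigma$ (notation of Bhargava–Shankar–Wang, "Squarefree values of polynomial discriminants I"). *)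

theory Defs
  imports
    Complex_Main
    "HOL-Computational_Algebra.Squarefree"
    "Subresultants.Resultant_Prelim"
begin

text \<open>The division by the leading coefficient is exact, since the leading coefficient divides the
  first column of the Sylvester matrix of \<open>f\<close> and its derivative.\<close>

definition disc :: "int poly \<Rightarrow> int" where
  "disc f = ((-1) ^ (degree f * (degree f - 1) div 2) * resultant f (pderiv f)) div lead_coeff f"

text \<open>For monic \<open>f\<close> of degree \<open>n\<close>, the coefficient \<open>a\<^sub>i\<close> of \<open>x\<^bsup>n-i\<^esup>\<close> has weight \<open>i\<close>.
  The notion is meaningful for degree at least 1 only (the maximum of the empty set is
  unspecified).\<close>

definition height :: "int poly \<Rightarrow> real" where
  "height f = Max ((\<lambda>i. root i \<bar>real_of_int (coeff f (degree f - i))\<bar>) ` {1..degree f})"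

definition strongly_divisible :: "nat \<Rightarrow> int poly \<Rightarrow> bool" where
  "strongly_divisible p f \<longleftrightarrow>
     (\<forall>g. degree g \<le> degree f - 1 \<longrightarrow> (int p)\<^sup>2 dvd disc (f + smult (int p) g))"

definition W1 :: "nat \<Rightarrow> nat \<Rightarrow> int poly set" where
  "W1 n s = {f. degree f = n \<and> lead_coeff f = 1 \<and>
                (\<forall>p. prime p \<longrightarrow> p dvd s \<longrightarrow> strongly_divisible p f)}"

text \<open>The sets of polynomials to be counted are finite, so that \<^const>\<open>card\<close> is their
  cardinality.\<close>

lemma height_le_iff:
  assumes "degree f \<ge> 1"
  shows "height f \<le> X \<longleftrightarrow> (\<forall>i\<in>{1..degree f}. root i \<bar>real_of_int (coeff f (degree f - i))\<bar> \<le> X)"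
  unfolding height_def using assms by (subst Max_le_iff) auto

lemma finite_height_le:
  assumes "n \<ge> 1"
  shows "finite {f \<in> W1 n s. height f \<le> X}"
    and "finite (\<Union>s\<in>S. {f \<in> W1 n s. height f \<le> X})"
proof -
  define B where "B = (\<Sum>i\<le>n. \<lceil>\<bar>X\<bar> ^ i\<rceil>)"
  let ?A = "{f :: int poly. degree f = n \<and> lead_coeff f = 1 \<and> height f \<le> X}"
  let ?L = "{xs :: int list. set xs \<subseteq> {-B..B} \<and> length xs = n}"
  have bound: "\<bar>coeff f k\<bar> \<le> B" if f: "f \<in> ?A" and k: "k < n" for f k
  proof -
    define i where "i = n - k"
    have i: "i \<in> {1..n}" "k = n - i" using k by (auto simp: i_def)
    have r: "root i \<bar>real_of_int (coeff f k)\<bar> \<le> X"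
      using f i assms by (auto simp: height_le_iff)
    have "\<bar>real_of_int (coeff f k)\<bar> = root i \<bar>real_of_int (coeff f k)\<bar> ^ i"
      using i by simp
    also have "\<dots> \<le> \<bar>X\<bar> ^ i"
      using r by (intro power_mono) (auto intro: real_root_ge_zero)
    finally have "\<bar>coeff f k\<bar> \<le> \<lceil>\<bar>X\<bar> ^ i\<rceil>"
      by linarith
    also have "\<dots> \<le> B"
      unfolding B_def
      using i by (intro member_le_sum) (auto intro: less_le_trans[of "-1" 0])
    finally show ?thesis .
  qed
  have "inj_on (\<lambda>f. map (coeff f) [0..<n]) ?A"
  proof (rule inj_onI)
    fix f g assume f: "f \<in> ?A" and g: "g \<in> ?A"
      and eq: "map (coeff f) [0..<n] = map (coeff g) [0..<n]"
    show "f = g"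
    proof (rule poly_eqI)
      fix k
      consider "k < n" | "k = n" | "k > n" by linarith
      then show "coeff f k = coeff g k"
      proof cases
        case 1 then show ?thesis using eq by (auto simp: map_eq_conv)
      next
        case 2 then show ?thesis using f g by auto
      next
        case 3 then show ?thesis using f g by (auto simp: coeff_eq_0)
      qed
    qed
  qed
  moreover have "(\<lambda>f. map (coeff f) [0..<n]) ` ?A \<subseteq> ?L"
  proof
    fix xs assume "xs \<in> (\<lambda>f. map (coeff f) [0..<n]) ` ?A"
    then obtain f where f: "f \<in> ?A" and xs: "xs = map (coeff f) [0..<n]" by blast
    show "xs \<in> ?L" using bound[OF f] by (auto simp: xs abs_le_iff minus_le_iff)
  qed
  moreover have "finite ?L" by (rule finite_lists_length_eq) auto
  ultimately have fin: "finite ?A" by (meson finite_imageD finite_subset)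
  show "finite {f \<in> W1 n s. height f \<le> X}"
    by (rule finite_subset[OF _ fin]) (auto simp: W1_def)
  show "finite (\<Union>s\<in>S. {f \<in> W1 n s. height f \<le> X})"
    by (rule finite_subset[OF _ fin]) (auto simp: W1_def)
qed

end

theory Submission
  imports
    Defs
    "HOL-Library.FuncSet"
    "HOL-Computational_Algebra.Field_as_Ring"
    "Jordan_Normal_Form.Char_Poly"
    "Subresultants.Subresultant_Gcd"
begin

text \<open>
  Write a monic polynomial as \<open>h + t\<close> with \<open>h(0) = 0\<close>. As a polynomial in \<open>t\<close>, its discriminant is,
  up to sign, a polynomial \<open>D\<close> of degree \<open>n - 1\<close> with leading coefficient \<open>n\<^sup>n\<close>. If the discriminant is
  strongly divisible by \<open>p\<^sup>2\<close>, then shifting \<open>t\<close> by \<open>p\<close> shows that \<open>p\<close> divides \<open>D(t)\<close> and \<open>D'(t)\<close>,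
  hence also the resultant \<open>R\<close> of \<open>D\<close> and \<open>D'\<close>, which depends on \<open>h\<close> only.

  If \<open>R \<noteq> 0\<close>, the modulus is one of the at most \<open>2\<^bsup>\<omega>(R)\<^esup>\<close> squarefree divisors \<open>s > M\<close> of \<open>R\<close>, and \<open>t\<close> lies in
  one of at most \<open>n\<^bsup>\<omega>(s)\<^esup>\<close> residue classes modulo \<open>s\<close>; here \<open>\<omega>(R) = O(log X / log log X)\<close>, since \<open>R\<close> is
  bounded by a power of \<open>X\<close>. If \<open>R = 0\<close>, then the coefficient \<open>y\<close> of \<open>x\<close> in \<open>h\<close> takes at most a
  constant number of values once the higher coefficients are fixed: \<open>R\<close> is weighted homogeneous, and
  it does not vanish at \<open>x\<^sup>n + x\<close>.\<close>

subsection \<open>Determinants and resultants\<close>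

text \<open>The convolution at the sum of two degree bounds has a single term that respects both
  bounds. The bounds \<open>d i\<close> may exceed the degrees, so the coefficients at them may be
  zero.\<close>

lemma coeff_prod_upper:
  fixes f :: "'i \<Rightarrow> 'a::comm_semiring_1 poly"
  assumes "finite I" "\<And>i. i \<in> I \<Longrightarrow> degree (f i) \<le> d i"
  shows "coeff (\<Prod>i\<in>I. f i) (\<Sum>i\<in>I. d i) = (\<Prod>i\<in>I. coeff (f i) (d i))
    \<and> degree (\<Prod>i\<in>I. f i) \<le> (\<Sum>i\<in>I. d i)"
  using assms
proof (induction rule: finite_induct)
  case empty
  then show ?case by simp
next
  case (insert x F)
  have IH: "coeff (\<Prod>i\<in>F. f i) (\<Sum>i\<in>F. d i) = (\<Prod>i\<in>F. coeff (f i) (d i))"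
    "degree (\<Prod>i\<in>F. f i) \<le> (\<Sum>i\<in>F. d i)" using insert by auto
  have dx: "degree (f x) \<le> d x" using insert by auto
  have *: "coeff (p * q) (a + b) = coeff p a * coeff q b"
    if "degree p \<le> a" "degree q \<le> b" for p q :: "'a poly" and a b
  proof -
    have "coeff (p * q) (a + b) = (\<Sum>i\<le>a+b. coeff p i * coeff q (a + b - i))"
      by (rule coeff_mult)
    also have "\<dots> = (\<Sum>i\<in>{a}. coeff p i * coeff q (a + b - i))"
    proof (rule sum.mono_neutral_right)
      show "\<forall>i\<in>{..a+b} - {a}. coeff p i * coeff q (a + b - i) = 0"
      proof
        fix i assume "i \<in> {..a+b} - {a}"
        then have "i > a \<or> a + b - i > b" by auto
        then show "coeff p i * coeff q (a + b - i) = 0"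
          using that by (auto simp: coeff_eq_0)
      qed
    qed auto
    finally show ?thesis by simp
  qed
  show ?case
    using insert IH dx by (auto simp: * intro!: order.trans[OF degree_mult_le] add_mono)
qed

text \<open>A Leibniz term takes one entry from each row, so bounds attached to the rows give all
  terms the same bound. The top coefficient of the determinant is thus itself a determinant of
  scalars.\<close>

lemma coeff_det_upper:
  fixes A :: "'a::comm_ring_1 poly mat"
  assumes A: "A \<in> carrier_mat N N"
    and d: "\<And>i j. i < N \<Longrightarrow> j < N \<Longrightarrow> degree (A $$ (i,j)) \<le> d i"
  shows "coeff (det A) (\<Sum>i<N. d i) = det (mat N N (\<lambda>(i,j). coeff (A $$ (i,j)) (d i)))"
    and "degree (det A) \<le> (\<Sum>i<N. d i)"
proof -
  have e: "coeff (\<Prod>i = 0..<N. A $$ (i, p i)) (\<Sum>i<N. d i) = (\<Prod>i = 0..<N. coeff (A $$ (i, p i)) (d i))"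
    "degree (\<Prod>i = 0..<N. A $$ (i, p i)) \<le> (\<Sum>i<N. d i)"
    if "p permutes {0..<N}" for p
  proof -
    have "p i < N" if "i < N" for i
      using permutes_in_image[OF \<open>p permutes {0..<N}\<close>, of i] that by auto
    then show "coeff (\<Prod>i = 0..<N. A $$ (i, p i)) (\<Sum>i<N. d i) = (\<Prod>i = 0..<N. coeff (A $$ (i, p i)) (d i))"
      "degree (\<Prod>i = 0..<N. A $$ (i, p i)) \<le> (\<Sum>i<N. d i)"
      using coeff_prod_upper[of "{0..<N}" "\<lambda>i. A $$ (i, p i)" d] d
      by (auto simp: atLeast0LessThan)
  qed
  have sg: "coeff (signof p * q) k = signof p * coeff q k" for p :: "nat \<Rightarrow> nat" and q :: "'a poly" and k
    by (auto simp: sign_def)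
  have dsg: "degree (signof p * q) = degree q" for p :: "nat \<Rightarrow> nat" and q :: "'a poly"
    by (auto simp: sign_def)
  have "det (mat N N (\<lambda>(i,j). coeff (A $$ (i,j)) (d i))) =
    (\<Sum>p | p permutes {0..<N}. signof p * (\<Prod>i = 0..<N. coeff (A $$ (i, p i)) (d i)))"
    by (subst det_def'[where n=N]) (auto intro!: sum.cong prod.cong)
  also have "\<dots> = coeff (det A) (\<Sum>i<N. d i)"
    unfolding det_def'[OF A] coeff_sum sg
    by (intro sum.cong refl) (auto simp: e)
  finally show "coeff (det A) (\<Sum>i<N. d i) = det (mat N N (\<lambda>(i,j). coeff (A $$ (i,j)) (d i)))" ..
  show "degree (det A) \<le> (\<Sum>i<N. d i)"
    unfolding det_def'[OF A]
    by (rule degree_sum_le) (auto simp: dsg e finite_permutations)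
qed

text \<open>Every Leibniz term uses each row and each column once, so row factors and column factors
  pull out as products that do not depend on the permutation.\<close>

lemma det_scaled:
  fixes A B :: "'a::comm_ring_1 mat"
  assumes A: "A \<in> carrier_mat N N" and B: "B \<in> carrier_mat N N"
    and eq: "\<And>i j. i < N \<Longrightarrow> j < N \<Longrightarrow> r i * B $$ (i,j) = c j * A $$ (i,j)"
  shows "(\<Prod>i<N. r i) * det B = (\<Prod>i<N. c i) * det A"
proof -
  have "(\<Prod>i<N. r i) * (signof p * (\<Prod>i = 0..<N. B $$ (i, p i))) =
    (\<Prod>i<N. c i) * (signof p * (\<Prod>i = 0..<N. A $$ (i, p i)))" if p: "p permutes {0..<N}" for p
  proof -
    have lt: "p i < N" if "i < N" for i using permutes_in_image[OF p, of i] that by auto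
    have "(\<Prod>i<N. r i) * (\<Prod>i = 0..<N. B $$ (i, p i)) = (\<Prod>i = 0..<N. c (p i) * A $$ (i, p i))"
      by (simp add: prod.distrib[symmetric] atLeast0LessThan eq lt)
    also have "\<dots> = (\<Prod>i = 0..<N. c (p i)) * (\<Prod>i = 0..<N. A $$ (i, p i))"
      by (rule prod.distrib)
    also have "(\<Prod>i = 0..<N. c (p i)) = (\<Prod>i<N. c i)"
      using prod.permute[OF p, of c] by (simp add: comp_def atLeast0LessThan)
    finally show ?thesis by (simp add: algebra_simps)
  qed
  then show ?thesis
    unfolding det_def'[OF A] det_def'[OF B] sum_distrib_left by (intro sum.cong) auto
qed

text \<open>Applied to the vector of powers \<open>t ^ (N - 1), ..., 1\<close>, the rows of the
  Sylvester matrix become multiples of \<open>poly f t\<close> or \<open>poly g t\<close>. A common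
  root, also one modulo a prime, thus passes on to the resultant.\<close>

lemma resultant_linear_combination:
  fixes f g :: "'a::comm_ring_1 poly"
  assumes "degree f + degree g > 0"
  shows "\<exists>a b. resultant f g = a * poly f t + b * poly g t"
proof -
  define m where "m = degree f"
  define k where "k = degree g"
  define N where "N = m + k"
  define S where "S = sylvester_mat f g"
  have S: "S \<in> carrier_mat N N" unfolding S_def N_def m_def k_def by (rule sylvester_carrier_mat)
  have N: "N > 0" using assms by (simp add: N_def m_def k_def)
  define w where "w i = (\<Sum>j<N. S $$ (i,j) * t ^ (N - 1 - j))" for i
  have w1: "w i = t ^ (k - 1 - i) * poly f t" if i: "i < k" for i
  proof -
    have "w i = (\<Sum>j\<in>{i..i+m}. coeff f (m + i - j) * t ^ (N - 1 - j))"
      unfolding w_def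
      by (rule sum.mono_neutral_cong_right)
        (use i in \<open>auto simp: S_def sylvester_index_mat N_def m_def k_def\<close>)
    also have "\<dots> = (\<Sum>l\<le>m. coeff f l * t ^ (k - 1 - i + l))"
      by (rule sum.reindex_bij_witness[of _ "\<lambda>l. m + i - l" "\<lambda>j. m + i - j"])
        (use i in \<open>auto simp: N_def intro!: arg_cong2[of _ _ _ _ "(*)"] arg_cong2[of _ _ _ _ "(^)"]\<close>)
    also have "\<dots> = t ^ (k - 1 - i) * poly f t"
      by (simp add: poly_altdef m_def sum_distrib_left power_add algebra_simps)
    finally show ?thesis .
  qed
  have w2: "w i = t ^ (N - 1 - i) * poly g t" if i: "i \<ge> k" "i < N" for i
  proof -
    have "w i = (\<Sum>j\<in>{i-k..i}. coeff g (i - j) * t ^ (N - 1 - j))"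
      unfolding w_def
      by (rule sum.mono_neutral_cong_right)
        (use i in \<open>auto simp: S_def sylvester_index_mat N_def m_def k_def\<close>)
    also have "\<dots> = (\<Sum>l\<le>k. coeff g l * t ^ (N - 1 - i + l))"
      by (rule sum.reindex_bij_witness[of _ "\<lambda>l. i - l" "\<lambda>j. i - j"])
        (use i in \<open>auto simp: N_def intro!: arg_cong2[of _ _ _ _ "(*)"] arg_cong2[of _ _ _ _ "(^)"]\<close>)
    also have "\<dots> = t ^ (N - 1 - i) * poly g t"
      by (simp add: poly_altdef k_def sum_distrib_left power_add algebra_simps)
    finally show ?thesis .
  qed
  \<comment> \<open>The last row of the adjugate times the Sylvester matrix is
    \<open>(0, ..., 0, det S)\<close>; pairing it with the powers of \<open>t\<close> leaves
    \<open>det S * t ^ 0\<close>.\<close>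
  define u where "u i = adj_mat S $$ (N - 1, i)" for i
  have row: "(\<Sum>i<N. u i * S $$ (i,j)) = (if j = N - 1 then det S else 0)" if j: "j < N" for j
  proof -
    have "(\<Sum>i<N. u i * S $$ (i,j)) = (adj_mat S * S) $$ (N - 1, j)"
      using N j S adj_mat(1)[OF S]
      by (auto simp: u_def times_mat_def scalar_prod_def atLeast0LessThan intro!: sum.cong)
    also have "\<dots> = (if j = N - 1 then det S else 0)"
      unfolding adj_mat(3)[OF S] using N j by auto
    finally show ?thesis .
  qed
  have "det S = (\<Sum>j<N. (if j = N - 1 then det S else 0) * t ^ (N - 1 - j))"
    using N by (simp add: if_distrib[of "\<lambda>x. x * _"] cong: if_cong)
  also have "\<dots> = (\<Sum>j<N. (\<Sum>i<N. u i * S $$ (i,j)) * t ^ (N - 1 - j))"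
    by (simp add: row)
  also have "\<dots> = (\<Sum>i<N. u i * w i)"
    unfolding w_def sum_distrib_left sum_distrib_right
    by (subst sum.swap) (simp add: mult.assoc)
  also have "{..<N} = {..<k} \<union> {k..<N}" by (auto simp: N_def)
  also have "(\<Sum>i\<in>{..<k} \<union> {k..<N}. u i * w i) = (\<Sum>i<k. u i * w i) + (\<Sum>i=k..<N. u i * w i)"
    by (rule sum.union_disjoint) auto
  also have "\<dots> = (\<Sum>i<k. u i * t ^ (k - 1 - i)) * poly f t + (\<Sum>i=k..<N. u i * t ^ (N - 1 - i)) * poly g t"
    by (simp add: w1 w2 sum_distrib_right mult.assoc)
  finally show ?thesis unfolding resultant_def S_def by blast
qed

text \<open>For monic \<open>p\<close> over a field and \<open>l \<noteq> 0\<close>, this is \<open>l\<^sup>n p(x / l)\<close> with \<open>n\<close> the degree of \<open>p\<close>: the coefficient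
  of weight \<open>i\<close> is multiplied by \<open>l\<^sup>i\<close>.\<close>

definition scale_poly :: "'a::comm_ring_1 \<Rightarrow> 'a poly \<Rightarrow> 'a poly" where
  "scale_poly l p = (\<Sum>k\<le>degree p. monom (l ^ (degree p - k) * coeff p k) k)"

lemma coeff_scale_poly: "coeff (scale_poly l p) k = l ^ (degree p - k) * coeff p k"
proof -
  have "coeff (scale_poly l p) k = (\<Sum>i\<le>degree p. if i = k then l ^ (degree p - i) * coeff p i else 0)"
    unfolding scale_poly_def by (simp add: coeff_sum)
  also have "\<dots> = l ^ (degree p - k) * coeff p k"
    by (auto simp: coeff_eq_0)
  finally show ?thesis .
qed

lemma degree_scale_poly [simp]: "degree (scale_poly l p) = degree p"
proof (rule antisym)
  show "degree (scale_poly l p) \<le> degree p"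
    by (rule degree_le) (auto simp: coeff_scale_poly coeff_eq_0)
  show "degree p \<le> degree (scale_poly l p)"
    by (cases "p = 0") (auto intro!: le_degree simp: coeff_scale_poly)
qed

lemma scale_poly_pderiv:
  fixes p :: "'a::{idom,ring_char_0} poly"
  shows "pderiv (scale_poly l p) = scale_poly l (pderiv p)"
  by (rule poly_eqI) (simp add: coeff_pderiv coeff_scale_poly degree_pderiv algebra_simps)

lemma poly_scale_poly:
  fixes l :: "'a::idom"
  shows "poly (scale_poly l p) (l * x) = l ^ degree p * poly p x"
proof -
  have "poly (scale_poly l p) (l * x) = (\<Sum>k\<le>degree p. l ^ (degree p - k) * coeff p k * (l * x) ^ k)"
    by (simp add: poly_altdef coeff_scale_poly)
  also have "\<dots> = (\<Sum>k\<le>degree p. l ^ degree p * (coeff p k * x ^ k))"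
    by (rule sum.cong) (auto simp: power_mult_distrib mult_ac simp flip: power_add)
  finally show ?thesis by (simp add: poly_altdef sum_distrib_left)
qed

lemma sum_lessThan_add: "(\<Sum>i<m + n. i) = (\<Sum>i<n. i) + (\<Sum>i<m. i) + m * (n::nat)"
  by (induction n) (auto simp: algebra_simps)

text \<open>After row \<open>i\<close> is multiplied by \<open>r i\<close>, column \<open>j\<close>
  of the scaled Sylvester matrix is \<open>l ^ j\<close> times the original one. The column
  exponents exceed the row exponents by \<open>degree p * degree q\<close> in total.\<close>

lemma resultant_scale_poly:
  fixes p q :: "'a::idom poly"
  assumes "l \<noteq> 0"
  shows "resultant (scale_poly l p) (scale_poly l q) = l ^ (degree p * degree q) * resultant p q"
proof -
  define m where "m = degree p"
  define n where "n = degree q"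
  \<comment> \<open>The exponent restarts at row \<open>n\<close>, where the block of
    \<open>q\<close> begins.\<close>
  define r where "r i = l ^ (if i < n then i else i - n)" for i
  have "(\<Prod>i<m+n. r i) * det (sylvester_mat (scale_poly l p) (scale_poly l q)) =
    (\<Prod>i<m+n. l ^ i) * det (sylvester_mat p q)"
  proof (rule det_scaled)
    fix i j assume "i < m + n" "j < m + n"
    moreover have "l ^ i * (l ^ (m - (m + i - j)) * x) = l ^ j * x" if "i \<le> j" "j - i \<le> m" for x
      using that by (simp add: mult.assoc[symmetric] power_add[symmetric])
    moreover have "l ^ (i - n) * (l ^ (n - (i - j)) * x) = l ^ j * x" if "i - n \<le> j" "j \<le> i" "\<not> i < n" for x
    proof -
      have "i - n + (n - (i - j)) = j" using that by auto
      then show ?thesis by (simp add: mult.assoc[symmetric] power_add[symmetric])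
    qed
    ultimately show "r i * sylvester_mat (scale_poly l p) (scale_poly l q) $$ (i, j) =
           l ^ j * sylvester_mat p q $$ (i, j)"
      by (auto simp: sylvester_index_mat m_def n_def r_def coeff_scale_poly)
  qed (auto simp: m_def n_def)
  moreover have "(\<Prod>i<m+n. l ^ i) = (\<Prod>i<m+n. r i) * l ^ (m * n)"
  proof -
    have "(\<Prod>i<m+n. r i) = (\<Prod>i<n. r i) * (\<Prod>i=n..<n+m. r i)"
      by (subst prod.union_disjoint[symmetric]) (auto intro!: prod.cong)
    also have "(\<Prod>i=n..<n+m. r i) = (\<Prod>i<m. r (i + n))"
      by (rule prod.reindex_bij_witness[of _ "\<lambda>i. i + n" "\<lambda>i. i - n"]) auto
    also have "(\<Prod>i<n. r i) * (\<Prod>i<m. r (i + n)) = l ^ ((\<Sum>i<n. i) + (\<Sum>i<m. i))"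
      by (simp add: r_def power_add power_sum)
    finally show ?thesis by (simp add: power_sum[symmetric] sum_lessThan_add power_add)
  qed
  moreover have "(\<Prod>i<m+n. r i) \<noteq> 0" using assms by (auto simp: r_def)
  ultimately show ?thesis by (simp add: resultant_def m_def n_def mult.assoc)
qed

subsection \<open>The discriminant as a function of the constant term\<close>

text \<open>This is \<open>h + t\<close> as a polynomial in \<open>x\<close>; the inner polynomial
  ring carries the indeterminate \<open>t\<close>.\<close>

definition shift_poly :: "'a::idom poly \<Rightarrow> 'a poly poly" where
  "shift_poly h = map_poly (\<lambda>c. [:c:]) h + [:[:0, 1:]:]"

lemma coeff_shift_poly: "coeff (shift_poly h) k = (if k = 0 then [:coeff h 0, 1:] else [:coeff h k:])"
  by (auto simp: shift_poly_def coeff_map_poly coeff_pCons split: nat.splits)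

text \<open>With the derivative as first argument, the entries containing \<open>t\<close> lie on
  the diagonal of the Sylvester matrix, which makes the leading coefficient in \<open>t\<close> easy
  to read off.\<close>

definition disc_poly :: "'a::idom poly \<Rightarrow> 'a poly" where
  "disc_poly h = resultant (map_poly (\<lambda>c. [:c:]) (pderiv h)) (shift_poly h)"

text \<open>For monic \<open>h\<close> of degree at least 2 in characteristic zero, this is nonzero
  exactly when the critical values of \<open>h\<close>, counted with multiplicity, are
  distinct.\<close>

definition disc_disc :: "'a::idom poly \<Rightarrow> 'a" where
  "disc_disc h = resultant (disc_poly h) (pderiv (disc_poly h))"

lemma degree_map_poly_const [simp]: "degree (map_poly (\<lambda>c. [:c:]) p) = degree p"
  by (rule degree_map_poly) auto

lemma degree_shift:
  assumes "degree h > 0"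
  shows "degree (shift_poly h) = degree h" "degree (h + [:t:]) = degree h"
  using assms by (auto simp: shift_poly_def degree_add_eq_left)

text \<open>Evaluation at \<open>t\<close> is a ring homomorphism that preserves both degrees, so it
  commutes with the resultant.\<close>

lemma poly_disc_poly:
  fixes h :: "'a::idom poly"
  assumes "degree h > 0"
  shows "poly (disc_poly h) t = resultant (pderiv h) (h + [:t:])"
proof -
  have *: "map_poly (\<lambda>p. poly p t) (map_poly (\<lambda>c. [:c:]) p) = p" for p :: "'a poly"
    by (rule poly_eqI) (simp add: coeff_map_poly)
  have s: "map_poly (\<lambda>p. poly p t) (shift_poly h) = h + [:t:]"
    by (rule poly_eqI) (simp add: coeff_map_poly coeff_shift_poly coeff_pCons split: nat.splits)
  show ?thesis
    unfolding disc_poly_def using poly_hom.resultant_map_poly[where a=t and p="map_poly (\<lambda>c. [:c:]) (pderiv h)" and q="shift_poly h"]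
    by (simp add: * s degree_shift assms)
qed

text \<open>The first \<open>n\<close> rows of the Sylvester matrix are free of \<open>t\<close>,
  the other \<open>n - 1\<close> rows at most linear in it. The coefficients at these row bounds
  form an upper triangular matrix with \<open>n\<close> entries \<open>n\<close> on the diagonal,
  followed by ones.\<close>

lemma disc_poly_upper:
  fixes h :: "'a::{idom,ring_char_0} poly"
  assumes n: "degree h = n" "n > 0" and monic: "lead_coeff h = 1"
  shows "degree (disc_poly h) = n - 1" "lead_coeff (disc_poly h) = of_nat n ^ n"
proof -
  let ?p = "map_poly (\<lambda>c. [:c:]) (pderiv h)"
  let ?q = "shift_poly h"
  define N where "N = n - 1 + n"
  define d :: "nat \<Rightarrow> nat" where "d i = (if i < n then 0 else 1)" for i
  have deg: "degree ?p = n - 1" "degree ?q = n"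
    using n degree_shift[of h] by (auto simp: degree_pderiv)
  let ?S = "sylvester_mat ?p ?q"
  have S: "?S \<in> carrier_mat N N" using sylvester_carrier_mat[of ?p ?q] by (simp only: deg N_def)
  have S_index: "?S $$ (i,j) =
    (if i < n then if i \<le> j \<and> j - i \<le> n - 1 then [:coeff (pderiv h) (n - 1 + i - j):] else 0
     else if i - n \<le> j \<and> j \<le> i then coeff (shift_poly h) (i - j) else 0)"
    if "i < N" "j < N" for i j
    using that[unfolded N_def] by (subst sylvester_index_mat; unfold deg) (simp_all add: coeff_map_poly)
  have sd: "(\<Sum>i<N. d i) = n - 1"
  proof -
    have "(\<Sum>i<N. d i) = (\<Sum>i\<in>{n..<N}. 1)"
      by (rule sum.mono_neutral_cong_right) (auto simp: d_def)
    then show ?thesis by (simp add: N_def)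
  qed
  have dle: "degree (?S $$ (i,j)) \<le> d i" if "i < N" "j < N" for i j
    using that by (auto simp: S_index coeff_shift_poly d_def coeff_pCons split: nat.splits)
  let ?B = "mat N N (\<lambda>(i,j). coeff (?S $$ (i,j)) (d i))"
  have "upper_triangular ?B"
    by (auto simp: upper_triangular_def S_index coeff_shift_poly d_def coeff_pCons split: nat.splits)
  then have "det ?B = prod_list (diag_mat ?B)" by (rule det_upper_triangular) auto
  also have "\<dots> = (\<Prod>i<N. if i < n then of_nat n else 1)"
    using n monic by (auto simp: prod_list_diag_prod atLeast0LessThan S_index coeff_shift_poly d_def coeff_pCons coeff_pderiv
      intro!: prod.cong split: nat.splits)
  also have "\<dots> = (\<Prod>i<n. of_nat n)"
    by (rule prod.mono_neutral_cong_right) (use n in \<open>auto simp: N_def\<close>)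
  finally have B: "det ?B = of_nat n ^ n" by simp
  have c: "coeff (disc_poly h) (n - 1) = of_nat n ^ n"
    using coeff_det_upper(1)[OF S dle] B by (simp add: sd disc_poly_def resultant_def)
  have le: "degree (disc_poly h) \<le> n - 1"
    using coeff_det_upper(2)[OF S dle] by (simp add: sd disc_poly_def resultant_def)
  have "coeff (disc_poly h) (n - 1) \<noteq> 0" unfolding c using n by simp
  with le show "degree (disc_poly h) = n - 1" by (intro antisym le_degree)
  with c show "lead_coeff (disc_poly h) = of_nat n ^ n" by simp
qed

text \<open>Resultants commute with homomorphisms that preserve degrees. Monicity of
  \<open>h\<close> and characteristic zero ensure this at both levels, since the leading coefficient
  \<open>n ^ n\<close> of \<open>disc_poly h\<close> stays nonzero.\<close>

lemma disc_disc_hom: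
  fixes \<phi> :: "'a::{idom,ring_char_0} \<Rightarrow> 'b::{idom,ring_char_0}"
  assumes hom: "idom_hom \<phi>" and n: "degree h = n" "n > 0" and monic: "lead_coeff h = 1"
  shows "disc_disc (map_poly \<phi> h) = \<phi> (disc_disc h)"
proof -
  interpret idom_hom \<phi> by (rule hom)
  interpret mp: map_poly_idom_hom \<phi> ..
  have dh: "degree (map_poly \<phi> h) = n" using n monic by (auto simp: intro!: degree_map_poly)
  have dp: "degree (pderiv (map_poly \<phi> h)) = n - 1" "degree (pderiv h) = n - 1"
    using n dh by (auto simp: degree_pderiv)
  have 0: "map_poly \<phi> (pCons c r) = pCons (\<phi> c) (map_poly \<phi> r)" for c r
    by (rule poly_eqI) (simp add: coeff_map_poly coeff_pCons split: nat.splits)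
  have 1: "map_poly (map_poly \<phi>) (map_poly (\<lambda>c. [:c:]) p) = map_poly (\<lambda>c. [:c:]) (map_poly \<phi> p)" for p
    by (rule poly_eqI) (simp add: coeff_map_poly 0)
  have 2: "map_poly (map_poly \<phi>) (shift_poly h) =
      shift_poly (map_poly \<phi> h)"
    by (rule poly_eqI) (simp add: coeff_map_poly coeff_shift_poly 0 split: nat.splits)
  have D: "disc_poly (map_poly \<phi> h) = map_poly \<phi> (disc_poly h)"
    unfolding disc_poly_def
    apply (subst mp.resultant_map_poly[symmetric])
    subgoal unfolding 1 by (simp add: dp map_poly_pderiv)
    subgoal unfolding 2 using n dh by (simp add: degree_shift)
    unfolding 1 2 by (simp add: map_poly_pderiv)
  have dD: "degree (map_poly \<phi> (disc_poly h)) = n - 1" "degree (disc_poly h) = n - 1"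
    using disc_poly_upper[of "map_poly \<phi> h" n] disc_poly_upper[of h n] dh n monic
    by (auto simp: D coeff_map_poly)
  show ?thesis
    unfolding disc_disc_def D map_poly_pderiv[symmetric]
    by (rule resultant_map_poly) (use dD in \<open>simp_all add: map_poly_pderiv degree_pderiv\<close>)
qed

text \<open>Weighted homogeneity: the constant term has weight \<open>n\<close>, so scaling
  \<open>h\<close> by \<open>l\<close> scales \<open>disc_poly h\<close> by \<open>l ^ n\<close>,
  and the second resultant changes by a power of \<open>l\<close>.\<close>

lemma disc_disc_scale:
  fixes h :: "'a::{idom,ring_char_0} poly"
  assumes n: "degree h = n" "n > 0" and monic: "lead_coeff h = 1" and l: "l \<noteq> 0"
  shows "disc_disc (scale_poly l h) = 0 \<longleftrightarrow> disc_disc h = 0"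
proof -
  have mon: "lead_coeff (scale_poly l h) = 1" using monic by (simp add: coeff_scale_poly)
  have shift: "scale_poly l h + [:l ^ n * t:] = scale_poly l (h + [:t:])" for t
    by (rule poly_eqI)
      (use degree_shift(2)[of h t] n in \<open>auto simp: coeff_scale_poly coeff_pCons algebra_simps split: nat.splits\<close>)
  have ev: "poly (disc_poly (scale_poly l h)) (l ^ n * t) = l ^ ((n - 1) * n) * poly (disc_poly h) t" for t
    using n l by (simp add: poly_disc_poly shift scale_poly_pderiv resultant_scale_poly degree_pderiv degree_shift)
  have "disc_poly (scale_poly l h) = scale_poly (l ^ n) (disc_poly h)"
  proof -
    \<comment> \<open>Both sides agree as functions of \<open>t\<close>, hence as polynomials; the
      substitution of \<open>l ^ n * t\<close> is then undone because \<open>l\<close> is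
      nonzero.\<close>
    have "disc_poly (scale_poly l h) \<circ>\<^sub>p [:0, l ^ n:] = scale_poly (l ^ n) (disc_poly h) \<circ>\<^sub>p [:0, l ^ n:]"
      unfolding poly_eq_poly_eq_iff[symmetric]
      using poly_scale_poly[of "l ^ n" "disc_poly h"] disc_poly_upper(1)[OF n monic]
      by (auto simp: fun_eq_iff poly_pcompose ev mult.commute[of _ "l ^ n"] power_mult[symmetric] mult.commute[of _ n])
    then have "coeff (disc_poly (scale_poly l h)) k = coeff (scale_poly (l ^ n) (disc_poly h)) k" for k
      using l by (simp add: poly_eq_iff coeff_pcompose_linear)
    then show ?thesis by (simp add: poly_eq_iff)
  qed
  then show ?thesis
    using l unfolding disc_disc_def by (simp add: scale_poly_pderiv resultant_scale_poly)
qed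

text \<open>Used both for the absolute value on the integers, which bounds the size of \<open>disc_disc\<close>, and for
  \<open>2\<^bsup>degree\<^esup>\<close> on integer polynomials, which bounds its degree in a parameter.\<close>

locale ring_norm =
  fixes N :: "'a::idom \<Rightarrow> real"
  assumes zero [simp]: "N 0 = 0" and one: "N 1 \<le> 1" and nonneg [simp]: "N x \<ge> 0"
    and minus [simp]: "N (- x) = N x"
    and add: "N (x + y) \<le> N x + N y" and mult: "N (x * y) \<le> N x * N y"
begin

lemma sum_le: "N (\<Sum>i\<in>I. f i) \<le> (\<Sum>i\<in>I. N (f i))"
proof (induction I rule: infinite_finite_induct)
  case (insert x F)
  then show ?case using add[of "f x" "\<Sum>i\<in>F. f i"] by auto
qed auto

lemma prod_le: "N (\<Prod>i\<in>I. f i) \<le> (\<Prod>i\<in>I. N (f i))"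
proof (induction I rule: infinite_finite_induct)
  case (insert x F)
  then show ?case
    using order.trans[OF mult[of "f x" "\<Prod>i\<in>F. f i"] mult_left_mono] by auto
qed (use one in auto)

lemma of_nat_le: "N (of_nat k) \<le> of_nat k"
proof (induction k)
  case (Suc k)
  then show ?case using add[of 1 "of_nat k"] one by auto
qed auto

lemma det_le:
  assumes A: "A \<in> carrier_mat n n" and B: "\<And>i j. i < n \<Longrightarrow> j < n \<Longrightarrow> N (A $$ (i,j)) \<le> B"
  shows "N (det A) \<le> fact n * B ^ n"
proof -
  have "N (det A) \<le> (\<Sum>p | p permutes {0..<n}. N (signof p * (\<Prod>i = 0..<n. A $$ (i, p i))))"
    unfolding det_def'[OF A] by (rule sum_le)
  also have "\<dots> \<le> (\<Sum>p | p permutes {0..<n}. B ^ n)"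
  proof (rule sum_mono)
    fix p assume "p \<in> {p. p permutes {0..<n}}"
    then have p: "p i < n" if "i < n" for i
      using permutes_in_image[of p "{0..<n}" i] that by auto
    have "N (signof p * (\<Prod>i = 0..<n. A $$ (i, p i))) = N (\<Prod>i = 0..<n. A $$ (i, p i))"
      by (auto simp: sign_def)
    also have "\<dots> \<le> (\<Prod>i = 0..<n. N (A $$ (i, p i)))" by (rule prod_le)
    also have "\<dots> \<le> (\<Prod>i = 0..<n. B)" using p by (intro prod_mono) (auto intro: B)
    finally show "N (signof p * (\<Prod>i = 0..<n. A $$ (i, p i))) \<le> B ^ n" by simp
  qed
  also have "\<dots> = fact n * B ^ n"
    using card_permutations[of "{0..<n}" n] by simp
  finally show ?thesis .
qed

lemma resultant_le:
  assumes "degree p + degree q = n" "\<And>i. N (coeff p i) \<le> B" "\<And>i. N (coeff q i) \<le> B"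
  shows "N (resultant p q) \<le> fact n * B ^ n"
  unfolding resultant_def
proof (rule det_le)
  show "sylvester_mat p q \<in> carrier_mat n n" using sylvester_carrier_mat[of p q] assms(1) by simp
  fix i j assume "i < n" "j < n"
  moreover have "0 \<le> B" using assms(2)[of 0] nonneg order.trans by blast
  ultimately show "N (sylvester_mat p q $$ (i, j)) \<le> B"
    using assms by (auto simp: sylvester_index_mat)
qed

text \<open>A sum rather than a maximum, because the maximum is not submultiplicative in general. It
  carries the resultant bound over to matrices with entries polynomial in \<open>t\<close>.\<close>

definition poly_norm :: "'a poly \<Rightarrow> real" where
  "poly_norm p = (\<Sum>i\<le>degree p. N (coeff p i))"

lemma poly_norm_altdef: "degree p \<le> m \<Longrightarrow> poly_norm p = (\<Sum>i\<le>m. N (coeff p i))"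
  unfolding poly_norm_def by (rule sum.mono_neutral_left) (auto simp: coeff_eq_0)

lemma poly_norm_pCons: "poly_norm (pCons a p) = N a + poly_norm p"
proof -
  have "poly_norm (pCons a p) = (\<Sum>i\<le>Suc (degree p). N (coeff (pCons a p) i))"
    by (rule poly_norm_altdef) (rule degree_pCons_le)
  then show ?thesis by (simp add: sum.atMost_Suc_shift poly_norm_def del: sum.atMost_Suc)
qed

lemma coeff_le_poly_norm: "N (coeff p i) \<le> poly_norm p"
proof (cases "i \<le> degree p")
  case True
  then show ?thesis unfolding poly_norm_def by (intro member_le_sum) auto
next
  case False
  then show ?thesis by (auto simp: coeff_eq_0 poly_norm_def intro: sum_nonneg)
qed

lemma ring_norm_poly_norm: "ring_norm poly_norm"
proof
  show add: "poly_norm (p + q) \<le> poly_norm p + poly_norm q" for p q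
  proof -
    have "poly_norm (p + q) = (\<Sum>i\<le>max (degree p) (degree q). N (coeff (p + q) i))"
      by (rule poly_norm_altdef) (rule degree_add_le_max)
    also have "\<dots> \<le> (\<Sum>i\<le>max (degree p) (degree q). N (coeff p i) + N (coeff q i))"
      by (intro sum_mono) (simp add: add)
    also have "\<dots> = poly_norm p + poly_norm q"
      by (simp add: sum.distrib poly_norm_altdef[symmetric])
    finally show ?thesis .
  qed
  have smult: "poly_norm (smult a q) \<le> N a * poly_norm q" for a q
  proof -
    have "poly_norm (smult a q) = (\<Sum>i\<le>degree q. N (a * coeff q i))"
      using poly_norm_altdef[OF degree_smult_le] by simp
    also have "\<dots> \<le> N a * poly_norm q"
      unfolding poly_norm_def sum_distrib_left by (intro sum_mono mult)
    finally show ?thesis .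
  qed
  show "poly_norm (p * q) \<le> poly_norm p * poly_norm q" for p q
  proof (induction p)
    case (pCons a p)
    have "poly_norm (pCons a p * q) \<le> poly_norm (smult a q) + poly_norm (pCons 0 (p * q))"
      by (simp add: add)
    also have "\<dots> \<le> N a * poly_norm q + poly_norm p * poly_norm q"
      using smult pCons by (intro add_mono) (auto simp: poly_norm_pCons)
    finally show ?case by (simp add: poly_norm_pCons algebra_simps)
  qed (simp add: poly_norm_def)
qed (use one in \<open>auto simp: poly_norm_def intro: sum_nonneg\<close>)

end

text \<open>The resultant bound is applied twice: with \<open>poly_norm\<close> to the matrix of
  size \<open>2 * n - 1\<close> over polynomials in \<open>t\<close>, then with \<open>N\<close> to
  the one of size \<open>2 * n - 3\<close>. The factors \<open>n + 1\<close> and \<open>n\<close>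
  absorb the derivatives and the extra coefficient of \<open>t\<close>.\<close>

lemma disc_disc_bound:
  fixes h :: "'a::{idom,ring_char_0} poly" and B :: real
  assumes N: "ring_norm N" and n: "degree h = n" "n > 0" and monic: "lead_coeff h = 1"
    and B: "B \<ge> 1" "\<And>i. N (coeff h i) \<le> B"
  shows "N (disc_disc h) \<le> fact (2*n-3) * (real n * (fact (2*n-1) * (real (n + 1) * B) ^ (2*n-1))) ^ (2*n-3)"
proof -
  interpret N: ring_norm N by (rule N)
  interpret P: ring_norm N.poly_norm by (rule N.ring_norm_poly_norm)
  have c: "N.poly_norm [:a:] = N a" for a by (simp add: N.poly_norm_def)
  have pd: "N (coeff (pderiv f) i) \<le> real (degree f) * C" if "\<And>i. N (coeff f i) \<le> C" for f i and C :: real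
  proof (cases "Suc i \<le> degree f")
    case True
    have "N (coeff (pderiv f) i) \<le> N (of_nat (Suc i)) * N (coeff f (Suc i))"
      unfolding coeff_pderiv by (rule N.mult)
    also have "\<dots> \<le> real (degree f) * C"
      using True N.of_nat_le[of "Suc i"] that by (intro mult_mono) auto
    finally show ?thesis .
  next
    case False
    have "0 \<le> C" using that[of 0] N.nonneg order.trans by blast
    then show ?thesis using False by (simp add: coeff_pderiv coeff_eq_0)
  qed
  have 1: "real n * B \<le> real (n + 1) * B" "B + 1 \<le> real (n + 1) * B"
    using B(1) n mult_mono[of 1 "real n" 1 B] by (auto simp: algebra_simps)
  have "N.poly_norm (disc_poly h) \<le> fact (2*n-1) * (real (n + 1) * B) ^ (2*n-1)"
    unfolding disc_poly_def
  proof (rule P.resultant_le)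
    show "degree (map_poly (\<lambda>c. [:c:]) (pderiv h)) + degree (shift_poly h) = 2 * n - 1"
      using n by (simp add: degree_shift degree_pderiv)
    show "N.poly_norm (coeff (map_poly (\<lambda>c. [:c:]) (pderiv h)) i) \<le> real (n + 1) * B" for i
      using order.trans[OF pd[OF B(2), of i, unfolded n(1)] 1(1)] by (simp add: coeff_map_poly c)
    have "N.poly_norm [:coeff h 0, 1:] \<le> B + 1"
      using B(2)[of 0] P.one by (simp add: N.poly_norm_pCons c)
    then show "N.poly_norm (coeff (shift_poly h) i) \<le> real (n + 1) * B" for i
      using B(2)[of i] 1 by (auto simp: coeff_shift_poly c)
  qed
  moreover define C where "C = fact (2*n-1) * (real (n + 1) * B) ^ (2*n-1)"
  ultimately have C: "N (coeff (disc_poly h) i) \<le> C" for i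
    using N.coeff_le_poly_norm[of "disc_poly h" i] by linarith
  have "C \<ge> 0" using B by (simp add: C_def)
  then have C1: "C \<le> real n * C" "real (n - 1) * C \<le> real n * C"
    using mult_right_mono[of 1 "real n" C] n(2) by (auto intro: mult_right_mono)
  have d: "degree (disc_poly h) = n - 1" using disc_poly_upper(1)[OF n monic] .
  show ?thesis
    unfolding disc_disc_def C_def[symmetric]
  proof (rule N.resultant_le)
    show "degree (disc_poly h) + degree (pderiv (disc_poly h)) = 2 * n - 3"
      by (simp add: d degree_pderiv)
    show "N (coeff (disc_poly h) i) \<le> real n * C" for i
      using C[of i] C1(1) by linarith
    show "N (coeff (pderiv (disc_poly h)) i) \<le> real n * C" for i
      using pd[OF C, of i] C1(2) unfolding d by linarith
  qed
qed

subsection \<open>Vanishing of the second discriminant\<close>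

text \<open>The critical points satisfy \<open>c ^ (n - 1) = - 1 / n\<close>, and the value there is
  \<open>(1 - 1 / n) * c\<close>, an injective function of \<open>c\<close> as \<open>n\<close> is
  at least 2.\<close>

lemma disc_disc_binomial_nonzero:
  assumes n: "n \<ge> 2"
  shows "disc_disc (monom 1 n + [:0, 1:] :: complex poly) \<noteq> 0"
proof -
  define h where "h = (monom 1 n + [:0, 1:] :: complex poly)"
  define D where "D = disc_poly h"
  have dh: "degree h = n" unfolding h_def using n by (subst degree_add_eq_left) (auto simp: degree_monom_eq)
  have "coeff h n = 1" using n by (auto simp: h_def coeff_pCons split: nat.splits)
  then have mon: "lead_coeff h = 1" by (simp add: dh)
  have D: "degree D = n - 1" "lead_coeff D = of_nat n ^ n"
    using disc_poly_upper[OF dh _ mon] n by (auto simp: D_def)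
  then have D0: "D \<noteq> 0" using n by auto
  define Z where "Z = {c :: complex. c ^ (n - 1) = - 1 / of_nat n}"
  have cZ: "card Z = n - 1" unfolding Z_def using n by (intro card_nth_roots) auto
  define t where "t c = - poly h c" for c
  have t: "t c = (1 / of_nat n - 1) * c" if "c \<in> Z" for c
  proof -
    have "c ^ n = c * c ^ (n - 1)" using n by (cases n) auto
    then show ?thesis using that n by (simp add: t_def h_def Z_def poly_monom field_simps)
  qed
  have fac: "1 / of_nat n - 1 \<noteq> (0::complex)"
  proof
    assume "1 / of_nat n - 1 = (0::complex)"
    then have "of_nat n = (of_nat 1 :: complex)" using n by (simp add: field_simps)
    then show False using n by (simp only: of_nat_eq_iff)
  qed
  \<comment> \<open>The \<open>n - 1\<close> critical values of \<open>x\<^sup>n + x\<close> are distinct, so they exhaust the roots of \<open>D\<close>.\<close>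
  have "inj_on t Z" using t fac by (auto simp: inj_on_def)
  then have card_t: "card (t ` Z) = n - 1" by (simp add: card_image cZ)
  have sub: "t ` Z \<subseteq> {z. poly D z = 0}"
  proof (clarify)
    fix c assume c: "c \<in> Z"
    have pd: "poly (pderiv h) c = 0"
      using c n by (simp add: h_def pderiv_add pderiv_monom poly_monom Z_def pderiv_pCons)
    have sh: "poly (h + [:t c:]) c = 0" by (simp add: t_def)
    have "degree (pderiv h) + degree (h + [:t c:]) > 0"
      using dh n degree_shift(2)[of h "t c"] by simp
    from resultant_linear_combination[OF this, of c] pd sh
    show "poly D (t c) = 0" using dh n by (simp add: D_def poly_disc_poly)
  qed
  have "card {z. poly D z = 0} = degree D"
    using card_mono[OF poly_roots_finite[OF D0] sub] card_poly_roots_bound[OF D0] card_t D by auto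
  then have "rsquarefree D" using rsquarefree_card_degree[OF D0] by simp
  then have no: "\<not> (poly D a = 0 \<and> poly (pderiv D) a = 0)" for a by (auto simp: rsquarefree_roots)
  show ?thesis
  proof
    assume "disc_disc (monom 1 n + [:0, 1:] :: complex poly) = 0"
    then have "resultant D (pderiv D) = 0" by (simp add: disc_disc_def D_def h_def)
    then have "degree (gcd D (pderiv D)) \<noteq> 0" by (simp add: resultant_0_gcd)
    then obtain z where "poly (gcd D (pderiv D)) z = 0"
      using fundamental_theorem_of_algebra[of "gcd D (pderiv D)"] by (auto simp: constant_degree)
    then have "poly D z = 0" "poly (pderiv D) z = 0"
      by (meson dvd_trans gcd_dvd1 gcd_dvd2 poly_eq_0_iff_dvd)+
    with no show False by blast
  qed
qed

section \<open>Two norms, and the count of degenerate linear coefficients\<close>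

lemma ring_norm_abs: "ring_norm (\<lambda>x::int. \<bar>real_of_int x\<bar>)"
  by unfold_locales (auto simp: abs_mult)

text \<open>The zero polynomial needs its own case, since \<open>degree 0 = 0\<close> would give it
  the value 1.\<close>

lemma ring_norm_degree: "ring_norm (\<lambda>p::int poly. if p = 0 then 0 else 2 ^ degree p)" (is "ring_norm ?N")
proof
  show "?N (p + q) \<le> ?N p + ?N q" for p q
  proof -
    have "2 ^ degree (p + q) \<le> (2::real) ^ max (degree p) (degree q)"
      by (intro power_increasing degree_add_le_max) auto
    also have "\<dots> \<le> 2 ^ degree p + 2 ^ degree q" by (auto simp: max_def)
    finally show ?thesis by auto
  qed
qed (auto simp: degree_mult_eq power_add)

text \<open>The bound of \<open>disc_disc_bound\<close> as a function of the coefficient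
  bound.\<close>

definition disc_disc_const :: "nat \<Rightarrow> real \<Rightarrow> real" where
  "disc_disc_const n B = fact (2*n-3) * (real n * (fact (2*n-1) * (real (n + 1) * B) ^ (2*n-1))) ^ (2*n-3)"

text \<open>A parameter \<open>u\<close> is attached to the coefficients of \<open>g\<close> according to their weights. If \<open>l\<^bsup>n-1\<^esup> = y\<close>, then
  \<open>g + y x\<close> is a rescaling by \<open>l\<close> of the member \<open>u = 1 / l\<close> of the family \<open>H\<close>, so distinct nonzero \<open>y\<close>
  give distinct roots \<open>u\<close> of a polynomial that does not vanish at \<open>u = 0\<close>.\<close>

lemma card_disc_disc_zero:
  fixes g :: "int poly"
  assumes n: "n \<ge> 2" "degree g = n" and monic: "lead_coeff g = 1"
    and low: "coeff g 0 = 0" "coeff g 1 = 0"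
  shows "finite {y. disc_disc (g + [:0, y:]) = 0}"
    and "real (card {y. disc_disc (g + [:0, y:]) = 0}) \<le> 1 + disc_disc_const n (2 ^ n)"
proof -
  \<comment> \<open>The inner variable is \<open>u\<close>: each coefficient of \<open>g\<close> is
    multiplied by \<open>u\<close> to its weight. The coefficient of \<open>x\<close> is 1, because
    that of \<open>g\<close> vanishes.\<close>
  define H :: "int poly poly" where "H = (\<Sum>k\<le>n. monom (monom (coeff g k) (n - k)) k) + [:0, 1:]"
  have cg: "coeff g k = 0" if "k > n" for k using that n by (simp add: coeff_eq_0)
  have cH: "coeff H k = monom (coeff g k) (n - k) + (if k = 1 then 1 else 0)" for k
  proof -
    have "coeff (\<Sum>k\<le>n. monom (monom (coeff g k) (n - k)) k) k =
        (\<Sum>i\<le>n. if i = k then monom (coeff g i) (n - i) else 0)"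
      by (simp add: coeff_sum)
    also have "\<dots> = monom (coeff g k) (n - k)" using cg[of k] by auto
    finally show ?thesis by (auto simp: H_def coeff_pCons split: nat.splits)
  qed
  have Hn: "coeff H n = 1" using n monic by (simp add: cH monom_0)
  have dH: "degree H = n"
  proof (rule antisym)
    show "degree H \<le> n" by (rule degree_le) (use n in \<open>auto simp: cH cg\<close>)
    show "n \<le> degree H" by (rule le_degree) (simp add: Hn)
  qed
  have mH: "lead_coeff H = 1" using Hn dH by simp
  let ?R = "disc_disc H"
  define \<phi> :: "complex \<Rightarrow> int poly \<Rightarrow> complex" where "\<phi> = (\<lambda>u p. poly (map_poly of_int p) u)"
  have hom: "idom_hom (\<phi> u)" for u
    unfolding \<phi>_def by unfold_locales (auto simp: hom_distribs)
  have \<phi>_coeff: "coeff (map_poly (\<phi> u) H) k = of_int (coeff g k) * u ^ (n - k) + (if k = 1 then 1 else 0)" for u k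
    by (subst coeff_map_poly) (auto simp: \<phi>_def cH hom_distribs poly_monom map_poly_monom)
  \<comment> \<open>At \<open>u = 0\<close> only the terms of \<open>x ^ n + x\<close>
    survive.\<close>
  have "map_poly (\<phi> 0) H = monom 1 n + [:0, 1:]"
    by (rule poly_eqI)
      (use n monic cg in \<open>auto simp: \<phi>_coeff coeff_pCons power_0_left not_less_eq_eq not_le split: nat.splits\<close>)
  then have "\<phi> 0 ?R \<noteq> 0"
    using disc_disc_hom[OF hom dH _ mH, of 0] disc_disc_binomial_nonzero[OF n(1)] n by auto
  then have R0: "?R \<noteq> 0" by (auto simp: \<phi>_def)
  \<comment> \<open>The coefficients of \<open>H\<close> have degree at most \<open>n\<close> in
    \<open>u\<close>, hence norm at most \<open>2 ^ n\<close>. The degree of \<open>?R\<close> is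
    then bounded through \<open>d < 2 ^ d\<close>.\<close>
  have "(if ?R = 0 then 0 else 2 ^ degree ?R) \<le> disc_disc_const n (2 ^ n)"
    unfolding disc_disc_const_def
  proof (rule disc_disc_bound[OF ring_norm_degree dH _ mH])
    fix k
    have "degree (coeff H k) \<le> n"
      using n degree_monom_le[of "coeff g k" "n - k"] low
      by (cases "k = 1") (auto simp: cH)
    then show "(if coeff H k = 0 then 0 else 2 ^ degree (coeff H k)) \<le> (2 ^ n :: real)"
      by auto
  qed (use n in auto)
  then have dR: "real (degree ?R) \<le> disc_disc_const n (2 ^ n)"
    using R0 order.trans[OF less_imp_le[OF of_nat_less_two_power]] by auto
  define U where "U = {u. \<phi> u ?R = 0}"
  have mR0: "map_poly complex_of_int ?R \<noteq> 0" using R0 by simp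
  have finU: "finite U" unfolding U_def \<phi>_def by (rule poly_roots_finite[OF mR0])
  have cU: "card U \<le> degree ?R" unfolding U_def \<phi>_def using card_poly_roots_bound[OF mR0] by simp
  define Y where "Y = {y. y \<noteq> 0 \<and> disc_disc (g + [:0, y:]) = 0}"
  have "\<exists>l::complex. l ^ (n - 1) = of_int y" if "y \<noteq> 0" for y
    using card_nth_roots[of "of_int y" "n - 1"] that n by (cases "{z::complex. z ^ (n - 1) = of_int y} = {}") auto
  then obtain L :: "int \<Rightarrow> complex" where L: "L y ^ (n - 1) = of_int y" if "y \<noteq> 0" for y by metis
  have "inverse (L y) \<in> U" if y: "y \<in> Y" for y
  proof -
    define l where "l = L y"
    have l: "l ^ (n - 1) = of_int y" "y \<noteq> 0" using L y by (auto simp: Y_def l_def)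
    then have l0: "l \<noteq> 0" using n by (auto simp: power_0_left)
    let ?G = "map_poly (\<phi> (inverse l)) H"
    let ?h = "g + [:0, y:]"
    have dh: "degree ?h = n" using n by (subst degree_add_eq_left) auto
    then have mh: "lead_coeff ?h = 1" using n monic by (auto simp: coeff_pCons split: nat.splits)
    have dG: "degree ?G = n"
    proof (rule antisym)
      show "degree ?G \<le> n" by (rule degree_le) (use n cg in \<open>auto simp: \<phi>_coeff\<close>)
      show "n \<le> degree ?G" by (rule le_degree) (use n monic in \<open>simp add: \<phi>_coeff\<close>)
    qed
    have mG: "lead_coeff ?G = 1" using dG n monic by (simp add: \<phi>_coeff)
    \<comment> \<open>The coefficient of \<open>x\<close> has weight \<open>n - 1\<close> and
      becomes \<open>l ^ (n - 1) = y\<close>; in the others the powers of \<open>l\<close> and of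
      its inverse cancel.\<close>
    have "scale_poly l ?G = map_poly of_int ?h"
    proof (rule poly_eqI)
      fix k
      have "l ^ (n - k) * inverse l ^ (n - k) = 1" using l0 by (simp add: power_inverse)
      then show "coeff (scale_poly l ?G) k = coeff (map_poly of_int ?h) k"
        unfolding coeff_scale_poly dG
        using l low cg[of k] by (auto simp: \<phi>_coeff coeff_pCons algebra_simps split: nat.splits)
    qed
    moreover have "disc_disc (map_poly complex_of_int ?h) = of_int (disc_disc ?h)"
      by (rule disc_disc_hom[OF _ dh _ mh]) (use n in \<open>auto intro: of_int_hom.idom_hom_axioms\<close>)
    ultimately have "disc_disc (scale_poly l ?G) = 0" using y by (simp add: Y_def)
    then have "disc_disc ?G = 0" using disc_disc_scale[OF dG _ mG l0] n by simp
    then show ?thesis using disc_disc_hom[OF hom dH _ mH] n by (simp add: U_def l_def)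
  qed
  then have img: "(\<lambda>y. inverse (L y)) ` Y \<subseteq> U" by blast
  have inj: "inj_on (\<lambda>y. inverse (L y)) Y"
  proof (rule inj_onI)
    fix x y assume xy: "x \<in> Y" "y \<in> Y" "inverse (L x) = inverse (L y)"
    then have "L x ^ (n - 1) = L y ^ (n - 1)" by simp
    then have "complex_of_int x = of_int y" using L[of x] L[of y] xy(1,2) unfolding Y_def by simp
    then show "x = y" by simp
  qed
  have finY: "finite Y" using finite_imageD[OF finite_subset[OF img finU] inj] .
  have cY: "card Y \<le> card U" using card_inj_on_le[OF inj img finU] .
  \<comment> \<open>The value \<open>y = 0\<close> has no inverse root attached to it and accounts
    for the summand 1 in the bound.\<close>
  have sub: "{y. disc_disc (g + [:0, y:]) = 0} \<subseteq> insert 0 Y" by (auto simp: Y_def)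
  then show "finite {y. disc_disc (g + [:0, y:]) = 0}" using finY finite_subset by blast
  have "card {y. disc_disc (g + [:0, y:]) = 0} \<le> card (insert 0 Y)"
    using sub finY by (intro card_mono) auto
  also have "\<dots> \<le> 1 + degree ?R" using cY cU finY by (simp add: card_insert_if)
  finally show "real (card {y. disc_disc (g + [:0, y:]) = 0}) \<le> 1 + disc_disc_const n (2 ^ n)"
    using dR by linarith
qed

subsection \<open>Prime factors and residue classes\<close>

text \<open>Split the primes at \<open>z\<close>: at most \<open>z\<close> of them are small, and
  the large ones have product at most \<open>m\<close>, so their number is at most
  \<open>ln m / ln z\<close>.\<close>

lemma card_prime_factors_le:
  fixes m :: nat and z :: real
  assumes m: "m > 0" and z: "z > 1"
  shows "real (card (prime_factors m)) \<le> z + ln m / ln z"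
proof -
  define A where "A = {p \<in> prime_factors m. real p \<le> z}"
  define B where "B = {p \<in> prime_factors m. real p > z}"
  have fin: "finite A" "finite B" by (auto simp: A_def B_def)
  have pos: "p \<ge> 1" if "p \<in> prime_factors m" for p
    using that in_prime_factors_imp_prime prime_ge_1_nat by blast
  have "A \<subseteq> {1..nat \<lfloor>z\<rfloor>}"
    using pos by (auto simp: A_def le_nat_floor)
  then have "card A \<le> nat \<lfloor>z\<rfloor>" using card_mono[of "{1..nat \<lfloor>z\<rfloor>}" A] by simp
  then have cA: "real (card A) \<le> z" using z by linarith
  have "z ^ card B = (\<Prod>p\<in>B. z)" by simp
  also have "\<dots> \<le> (\<Prod>p\<in>B. real p)" using z by (intro prod_mono) (auto simp: B_def)
  also have "\<dots> = real (\<Prod>B)" by simp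
  also have "real (\<Prod>B) \<le> real (\<Prod>p\<in>prime_factors m. p ^ multiplicity p m)"
  proof -
    have "\<Prod>B \<le> (\<Prod>p\<in>B. p ^ multiplicity p m)"
    proof (rule prod_mono)
      fix p assume "p \<in> B"
      then have "p \<in> prime_factors m" by (simp add: B_def)
      then show "0 \<le> p \<and> p \<le> p ^ multiplicity p m"
        using pos[of p] by (auto simp: prime_factors_multiplicity intro!: self_le_power)
    qed
    also have "\<dots> \<le> (\<Prod>p\<in>prime_factors m. p ^ multiplicity p m)"
      by (rule dvd_imp_le[OF prod_dvd_prod_subset])
        (auto simp: B_def dest: pos intro!: prod_pos)
    finally show ?thesis by (rule of_nat_mono)
  qed
  also have "(\<Prod>p\<in>prime_factors m. p ^ multiplicity p m) = m"
    using prod_prime_factors[of m] m by simp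
  finally have "z ^ card B \<le> real m" .
  then have "ln (z ^ card B) \<le> ln (real m)" using z m by (subst ln_le_cancel_iff) auto
  then have "real (card B) * ln z \<le> ln m" using z by (simp add: ln_realpow)
  then have cB: "real (card B) \<le> ln m / ln z" using z by (simp add: field_simps)
  have "prime_factors m = A \<union> B" by (auto simp: A_def B_def)
  then have "card (prime_factors m) \<le> card A + card B" by (simp add: card_Un_le)
  then show ?thesis using cA cB by linarith
qed

lemma prod_primes_dvd:
  fixes x :: int
  assumes "finite I" "\<And>p. p \<in> I \<Longrightarrow> prime (p::nat)" "\<And>p. p \<in> I \<Longrightarrow> int p dvd x"
  shows "int (\<Prod>I) dvd x"
  using assms
proof (induction I rule: finite_induct)
  case (insert p F)
  have "coprime p (\<Prod>F)"
    by (rule prod_coprime_right) (use insert in \<open>auto intro!: primes_coprime\<close>)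
  then have "coprime (int p) (int (\<Prod>F))" by (simp only: coprime_int_iff)
  then have "int p * int (\<Prod>F) dvd x" using insert by (intro divides_mult) auto
  then show ?case using insert by simp
qed auto

lemma squarefree_eq_prod_prime_factors:
  fixes s :: nat
  assumes "squarefree s"
  shows "s = \<Prod>(prime_factors s)"
proof -
  have s: "s \<noteq> 0" using assms by (metis not_squarefree_0)
  have "s = (\<Prod>p\<in>prime_factors s. p ^ multiplicity p s)" using prod_prime_factors[OF s] by simp
  also have "\<dots> = \<Prod>(prime_factors s)"
    using assms s by (intro prod.cong) (auto simp: squarefree_factorial_semiring')
  finally show ?thesis .
qed

lemma squarefree_dvd_int:
  fixes s :: nat and x :: int
  assumes "squarefree s" "\<And>p. prime p \<Longrightarrow> p dvd s \<Longrightarrow> int p dvd x"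
  shows "int s dvd x"
  by (subst squarefree_eq_prod_prime_factors[OF assms(1)], rule prod_primes_dvd)
    (auto intro: assms simp: in_prime_factors_iff)

text \<open>A squarefree number is determined by its set of prime factors.\<close>

lemma card_squarefree_divisors_le:
  fixes m :: nat
  assumes "m > 0"
  shows "finite {s. squarefree s \<and> s dvd m}" "card {s. squarefree s \<and> s dvd m} \<le> 2 ^ card (prime_factors m)"
proof -
  let ?S = "{s. squarefree s \<and> s dvd m}"
  show fin: "finite ?S" using finite_divisors_nat[OF assms] by (rule finite_subset[rotated]) auto
  have "inj_on prime_factors ?S"
    by (rule inj_onI) (metis (no_types, lifting) mem_Collect_eq squarefree_eq_prod_prime_factors)
  moreover have "prime_factors ` ?S \<subseteq> Pow (prime_factors m)"
    using assms dvd_prime_factors[of m] by auto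
  ultimately show "card ?S \<le> 2 ^ card (prime_factors m)"
    using card_inj_on_le[of prime_factors ?S "Pow (prime_factors m)"] by (simp add: card_Pow)
qed

text \<open>Lagrange's bound, with the induction carried out over the integers: division by
  \<open>x - a\<close> leaves the remainder \<open>poly f a\<close>, divisible by \<open>p\<close>,
  and a quotient with the same leading coefficient.\<close>

lemma card_roots_mod_prime:
  fixes f :: "int poly"
  assumes p: "prime p" and "\<not> p dvd lead_coeff f"
  shows "card {r \<in> {0..<p}. p dvd poly f r} \<le> degree f"
  using assms(2)
proof (induction "degree f" arbitrary: f)
  case 0
  then obtain c where "f = [:c:]" using degree0_coeffs[of f] by auto
  then show ?case using 0 by simp
next
  case (Suc d)
  let ?S = "\<lambda>f. {r \<in> {0..<p}. p dvd poly f r}"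
  show ?case
  proof (cases "?S f = {}")
    case False
    then obtain a where a: "p dvd poly f a" by auto
    define q where "q = synthetic_div f a"
    have f: "f = [:-a, 1:] * q + [:poly f a:]" unfolding q_def by (rule synthetic_div_correct'[symmetric])
    have dq: "degree q = d" using Suc(2) by (simp add: q_def degree_synthetic_div)
    have "coeff f (Suc d) = coeff q d"
      using dq by (subst f) (simp add: coeff_eq_0)
    then have "\<not> p dvd lead_coeff q" using Suc dq by metis
    then have IH: "card (?S q) \<le> d" using Suc(1)[of q] dq by simp
    have "?S f \<subseteq> insert (a mod p) (?S q)"
    proof
      fix r assume r: "r \<in> ?S f"
      have "poly f r = (r - a) * poly q r + poly f a" by (subst f) (simp add: algebra_simps)
      then have "p dvd (r - a) * poly q r" using r a by (metis (no_types, lifting) dvd_add_left_iff mem_Collect_eq)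
      then have "p dvd r - a \<or> p dvd poly q r" using p by (rule prime_dvd_multD[rotated])
      then show "r \<in> insert (a mod p) (?S q)"
      proof
        assume "p dvd r - a"
        then have "r mod p = a mod p" by (simp add: mod_eq_dvd_iff)
        then show ?thesis using r by simp
      qed (use r in auto)
    qed
    moreover have "finite (?S q)" by (rule finite_subset[of _ "{0..<p}"]) auto
    ultimately have "card (?S f) \<le> card (insert (a mod p) (?S q))" by (intro card_mono) auto
    also have "\<dots> \<le> Suc (card (?S q))" by (rule card_insert_le_m1) auto
    finally show ?thesis using IH Suc(2) by simp
  qed (simp only: card.empty)
qed

text \<open>The injective half of the Chinese remainder theorem: a residue modulo the product is
  determined by its residues modulo the primes.\<close>

lemma card_mod_prod_primes_le:
  fixes P :: "nat \<Rightarrow> int \<Rightarrow> bool"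
  assumes I: "finite I" "\<And>p. p \<in> I \<Longrightarrow> prime p"
    and n: "\<And>p. p \<in> I \<Longrightarrow> card {r \<in> {0..<int p}. P p r} \<le> n"
    and per: "\<And>p r. P p (r mod int p) = P p r"
  shows "card {t \<in> {0..<int (\<Prod>I)}. \<forall>p\<in>I. P p t} \<le> n ^ card I"
proof -
  let ?T = "{t \<in> {0..<int (\<Prod>I)}. \<forall>p\<in>I. P p t}"
  let ?R = "\<lambda>p. {r \<in> {0..<int p}. P p r}"
  let ?f = "\<lambda>t. \<lambda>p\<in>I. t mod int p"
  have "inj_on ?f ?T"
  proof (rule inj_onI)
    fix t u assume t: "t \<in> ?T" and u: "u \<in> ?T" and eq: "?f t = ?f u"
    have "int p dvd t - u" if "p \<in> I" for p
      using fun_cong[OF eq, of p] that by (simp add: mod_eq_dvd_iff)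
    then have "int (\<Prod>I) dvd t - u" using prod_primes_dvd[OF I] by blast
    then have "t mod int (\<Prod>I) = u mod int (\<Prod>I)" by (simp only: mod_eq_dvd_iff)
    then show "t = u" using t u by simp
  qed
  moreover have "?f ` ?T \<subseteq> PiE I ?R"
    using I(2) by (auto simp: per prime_gt_0_nat)
  moreover have "finite (PiE I ?R)"
    using I(1) by (intro finite_PiE) (auto intro: finite_subset[of _ "{0..<int _}"])
  ultimately have "card ?T \<le> card (PiE I ?R)" by (rule card_inj_on_le)
  also have "\<dots> = (\<Prod>p\<in>I. card (?R p))" using I(1) by (rule card_PiE)
  also have "\<dots> \<le> (\<Prod>p\<in>I. n)" by (rule prod_mono) (use n in simp)
  finally show ?thesis by simp
qed

text \<open>The interval, moved to start at 0, meets at most \<open>2 * L div s + 1\<close> blocks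
  of length \<open>s\<close>; block and residue together determine \<open>t\<close>.\<close>

lemma card_interval_mod_le:
  fixes s :: nat and P :: "int \<Rightarrow> bool"
  assumes s: "s > 0" and L: "L \<ge> 0" and per: "\<And>t. P (t mod int s) = P t"
  shows "real (card {t \<in> {-L..L}. P t}) \<le> (2 * real_of_int L / real s + 1) * real (card {t \<in> {0..<int s}. P t})"
proof -
  let ?A = "{t \<in> {-L..L}. P t}" and ?B = "{t \<in> {0..<int s}. P t}"
  have "finite ?B" by (rule finite_subset[of _ "{0..<int s}"]) auto
  let ?f = "\<lambda>t. ((t + L) div int s, t mod int s)"
  have "inj_on ?f ?A"
  proof (rule inj_onI)
    fix t u assume "?f t = ?f u"
    then have 1: "(t + L) div int s = (u + L) div int s" and "t mod int s = u mod int s" by auto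
    then have "(t + L) mod int s = (u + L) mod int s" by (intro mod_add_cong) auto
    with 1 have "t + L = u + L" by (metis div_mult_mod_eq)
    then show "t = u" by simp
  qed
  moreover have "?f ` ?A \<subseteq> {0..2 * L div int s} \<times> ?B"
    using s L per by (auto simp: pos_imp_zdiv_nonneg_iff intro!: zdiv_mono1)
  ultimately have "card ?A \<le> card ({0..2 * L div int s} \<times> ?B)"
    using \<open>finite ?B\<close> by (intro card_inj_on_le) auto
  also have "\<dots> = nat (2 * L div int s + 1) * card ?B" by (simp add: card_cartesian_product)
  finally have "real (card ?A) \<le> real (nat (2 * L div int s + 1)) * real (card ?B)"
    by (metis of_nat_le_iff of_nat_mult)
  also have "\<dots> \<le> (2 * real_of_int L / real s + 1) * real (card ?B)"
  proof (rule mult_right_mono)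
    have "2 * L div int s \<ge> 0" using s L by (simp add: pos_imp_zdiv_nonneg_iff)
    then have "real (nat (2 * L div int s + 1)) = real_of_int (2 * L div int s) + 1" by simp
    also have "real_of_int (2 * L div int s) \<le> real_of_int (2 * L) / real_of_int (int s)"
      by (rule real_of_int_div4)
    finally show "real (nat (2 * L div int s + 1)) \<le> 2 * real_of_int L / real s + 1" by simp
  qed auto
  finally show ?thesis .
qed

subsection \<open>Strong divisibility\<close>

lemma poly_taylor_square:
  fixes f :: "'a::idom poly"
  shows "\<exists>q. poly f (t + e) = poly f t + e * poly (pderiv f) t + e\<^sup>2 * q"
proof (induction f)
  case (pCons a f)
  then obtain q where q: "poly f (t + e) = poly f t + e * poly (pderiv f) t + e\<^sup>2 * q" by blast
  have "poly (pCons a f) (t + e) = poly (pCons a f) t + e * poly (pderiv (pCons a f)) t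
      + e\<^sup>2 * (poly (pderiv f) t + (t + e) * q)"
    unfolding poly_pCons pderiv_pCons poly_add q by (simp add: algebra_simps power2_eq_square)
  then show ?case by blast
qed auto

text \<open>For a monic polynomial \<open>disc\<close> is the resultant with the derivative up to
  sign, and exchanging the arguments costs another sign; \<open>e\<close> collects both.\<close>

lemma disc_dvd_iff:
  assumes n: "degree h = n" "n > 0" and monic: "lead_coeff h = 1"
  shows "k dvd disc (h + [:t:]) \<longleftrightarrow> k dvd poly (disc_poly h) t"
proof -
  let ?f = "h + [:t:]"
  have df: "degree ?f = n" using n by (simp add: degree_shift)
  have lf: "lead_coeff ?f = 1" using n monic df by (auto simp: coeff_pCons split: nat.splits)
  have pf: "pderiv ?f = pderiv h" by (simp add: pderiv_add pderiv_pCons)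
  have rs: "resultant ?f (pderiv h) = (- 1) ^ (n * (n - 1)) * resultant (pderiv h) ?f"
    using resultant_swap[of ?f "pderiv h"] by (simp only: df degree_pderiv n)
  define e :: int where "e = (- 1) ^ (n * (n - 1) div 2 + n * (n - 1))"
  have "disc ?f = e * poly (disc_poly h) t"
    unfolding disc_def df lf[unfolded df] pf rs using n by (simp add: poly_disc_poly e_def power_add)
  moreover have "e = 1 \<or> e = - 1" unfolding e_def by (simp only: minus_one_power_iff) auto
  ultimately show ?thesis by auto
qed

text \<open>Strong divisibility is applied to constant \<open>g\<close>, which move \<open>t\<close>
  by multiples of \<open>p\<close>. Taylor expansion at \<open>t + p\<close> modulo
  \<open>p ^ 2\<close> isolates \<open>p\<close> times the derivative, and the resultant is a
  combination of both values.\<close>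

lemma strongly_divisible_imp_dvd:
  assumes n: "degree h = n" "n \<ge> 2" and monic: "lead_coeff h = 1" and p: "prime p"
    and sd: "strongly_divisible p (h + [:t:])"
  shows "int p dvd poly (disc_poly h) t" "int p dvd poly (pderiv (disc_poly h)) t"
    "int p dvd disc_disc h"
proof -
  let ?D = "disc_poly h"
  have 1: "(int p)\<^sup>2 dvd poly ?D (t + int p * c)" for c
  proof -
    have "(int p)\<^sup>2 dvd disc (h + [:t:] + smult (int p) [:c:])"
      using sd[unfolded strongly_divisible_def, rule_format, of "[:c:]"] by simp
    also have "h + [:t:] + smult (int p) [:c:] = h + [:t + int p * c:]" by simp
    finally show ?thesis using disc_dvd_iff[OF n(1) _ monic, of "(int p)\<^sup>2" "t + int p * c"] n by simp
  qed
  then have 0: "(int p)\<^sup>2 dvd poly ?D t" using 1[of 0] by simp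
  then show D: "int p dvd poly ?D t" by (meson dvd_power dvd_trans pos2)
  obtain q where "poly ?D (t + int p) = poly ?D t + int p * poly (pderiv ?D) t + (int p)\<^sup>2 * q"
    using poly_taylor_square by blast
  then have "int p * poly (pderiv ?D) t = poly ?D (t + int p) - poly ?D t - (int p)\<^sup>2 * q" by simp
  then have "(int p)\<^sup>2 dvd int p * poly (pderiv ?D) t" using 0 1[of 1] by simp
  then show D': "int p dvd poly (pderiv ?D) t"
    using p by (simp add: power2_eq_square prime_gt_0_nat)
  have dpos: "degree ?D + degree (pderiv ?D) > 0" using disc_poly_upper(1)[OF n(1) _ monic] n by simp
  obtain a b where "disc_disc h = a * poly ?D t + b * poly (pderiv ?D) t"
    unfolding disc_disc_def using resultant_linear_combination[OF dpos, of t] by blast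
  then show "int p dvd disc_disc h" using D D' by simp
qed

text \<open>The leading coefficient \<open>n ^ n\<close> vanishes modulo the primes dividing
  \<open>n\<close>. Such primes are at most \<open>n\<close>, so counting all residues suffices; for
  the others Lagrange's bound gives \<open>n - 1\<close>.\<close>

lemma card_disc_roots_mod_prime:
  assumes n: "degree h = n" "n \<ge> 2" and monic: "lead_coeff h = 1" and p: "prime p"
  shows "card {r \<in> {0..<int p}. int p dvd poly (disc_poly h) r} \<le> n"
proof (cases "p dvd n")
  case True
  then have "p \<le> n" using n by (auto intro: dvd_imp_le)
  moreover have "card {r \<in> {0..<int p}. int p dvd poly (disc_poly h) r} \<le> card {0..<int p}"
    by (rule card_mono) auto
  ultimately show ?thesis by simp
next
  case False
  have "\<not> p dvd n ^ n" using False p prime_dvd_power by blast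
  then have "\<not> int p dvd int (n ^ n)" unfolding int_dvd_int_iff .
  then have "\<not> int p dvd lead_coeff (disc_poly h)"
    using disc_poly_upper(2)[OF n(1) _ monic] n by simp
  then have "card {r \<in> {0..<int p}. int p dvd poly (disc_poly h) r} \<le> degree (disc_poly h)"
    using p by (intro card_roots_mod_prime) auto
  then show ?thesis using disc_poly_upper(1)[OF n(1) _ monic] n by simp
qed

lemma poly_mod_dvd:
  fixes f :: "int poly"
  shows "m dvd poly f (r mod m) \<longleftrightarrow> m dvd poly f r"
proof -
  have "m dvd poly f r - poly f (r mod m)"
  proof (induction f)
    case (pCons a f)
    have "poly (pCons a f) r - poly (pCons a f) (r mod m) =
        r * (poly f r - poly f (r mod m)) + (r - r mod m) * poly f (r mod m)"
      by (simp add: algebra_simps)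
    moreover have "m dvd r - r mod m" by simp
    ultimately show ?case using pCons by simp
  qed simp
  then show ?thesis
    using dvd_diff[of m "poly f r" "poly f r - poly f (r mod m)"]
      dvd_add[of m "poly f r - poly f (r mod m)" "poly f (r mod m)"] by auto
qed

lemma card_disc_roots_mod_squarefree:
  assumes n: "degree h = n" "n \<ge> 2" and monic: "lead_coeff h = 1" and s: "squarefree s" and L: "L \<ge> 0"
  shows "real (card {t \<in> {-L..L}. \<forall>p\<in>prime_factors s. int p dvd poly (disc_poly h) t})
    \<le> (2 * real_of_int L / real s + 1) * real n ^ card (prime_factors s)"
proof -
  have s0: "s > 0" using s by (metis gr0I not_squarefree_0)
  let ?P = "\<lambda>t. \<forall>p\<in>prime_factors s. int p dvd poly (disc_poly h) t"
  have "(t mod int s) mod int p = t mod int p" if "p \<in> prime_factors s" for p t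
    using that by (intro mod_mod_cancel) auto
  then have per: "?P (t mod int s) = ?P t" for t
    by (metis (no_types, lifting) poly_mod_dvd)
  have "card {t \<in> {0..<int (\<Prod>(prime_factors s))}. ?P t} \<le> n ^ card (prime_factors s)"
    using card_disc_roots_mod_prime[OF n monic]
    by (intro card_mod_prod_primes_le[where P = "\<lambda>p t. int p dvd poly (disc_poly h) t"])
      (auto simp: poly_mod_dvd)
  then have c: "card {t \<in> {0..<int s}. ?P t} \<le> n ^ card (prime_factors s)"
    unfolding squarefree_eq_prod_prime_factors[OF s, symmetric] .
  have "real (card {t \<in> {-L..L}. ?P t}) \<le> (2 * real_of_int L / real s + 1) * real (card {t \<in> {0..<int s}. ?P t})"
    by (rule card_interval_mod_le[where P = ?P, OF s0 L per])
  also have "\<dots> \<le> (2 * real_of_int L / real s + 1) * real (n ^ card (prime_factors s))"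
    using c L by (intro mult_left_mono of_nat_mono) auto
  finally show ?thesis by simp
qed

text \<open>The modulus \<open>s\<close> varies with \<open>t\<close> but always divides the fixed
  nonzero integer \<open>disc_disc h\<close>. A union bound over these \<open>s\<close> combines the
  factor 2 per prime for the choice of \<open>s\<close> with the factor \<open>n\<close> per prime
  for the residue classes.\<close>

lemma card_strongly_divisible_shifts:
  assumes n: "degree h = n" "n \<ge> 2" and monic: "lead_coeff h = 1" and R: "disc_disc h \<noteq> 0"
    and L: "L \<ge> 0" and M: "M > 0"
  shows "real (card {t \<in> {-L..L}. \<exists>s. real s > M \<and> squarefree s \<and>
      (\<forall>p. prime p \<longrightarrow> p dvd s \<longrightarrow> strongly_divisible p (h + [:t:]))})
    \<le> (2 * real_of_int L / M + 1) * (2 * real n) ^ card (prime_factors (nat \<bar>disc_disc h\<bar>))"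
proof -
  define m where "m = nat \<bar>disc_disc h\<bar>"
  have m: "m > 0" using R by (simp add: m_def)
  define \<omega> where "\<omega> = card (prime_factors m)"
  define S where "S = {s. squarefree s \<and> s dvd m \<and> real s > M}"
  have SS: "S \<subseteq> {s. squarefree s \<and> s dvd m}" by (auto simp: S_def)
  have finS: "finite S" using finite_subset[OF SS] card_squarefree_divisors_le(1)[OF m] by blast
  have "card S \<le> 2 ^ \<omega>"
    using card_mono[OF card_squarefree_divisors_le(1)[OF m] SS] card_squarefree_divisors_le(2)[OF m]
    by (simp add: \<omega>_def)
  then have cS: "real (card S) \<le> 2 ^ \<omega>" by (metis of_nat_le_iff of_nat_numeral of_nat_power)
  let ?T = "{t \<in> {-L..L}. \<exists>s. real s > M \<and> squarefree s \<and>
      (\<forall>p. prime p \<longrightarrow> p dvd s \<longrightarrow> strongly_divisible p (h + [:t:]))}"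
  define T where "T s = {t \<in> {-L..L}. \<forall>p\<in>prime_factors s. int p dvd poly (disc_poly h) t}" for s
  have finT: "finite (T s)" for s unfolding T_def by (rule finite_subset[of _ "{-L..L}"]) auto
  have sub: "?T \<subseteq> (\<Union>s\<in>S. T s)"
  proof
    fix t assume "t \<in> ?T"
    then obtain s where t: "t \<in> {-L..L}" and s: "real s > M" "squarefree s"
      and sd: "\<And>p. prime p \<Longrightarrow> p dvd s \<Longrightarrow> strongly_divisible p (h + [:t:])" by blast
    have "int s dvd disc_disc h"
      by (rule squarefree_dvd_int[OF s(2)]) (rule strongly_divisible_imp_dvd(3)[OF n monic _ sd])
    moreover have "int m = \<bar>disc_disc h\<bar>" by (simp add: m_def)
    ultimately have "int s dvd int m" by simp
    then have "s dvd m" by (simp only: int_dvd_int_iff)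
    then have "s \<in> S" using s by (simp add: S_def)
    moreover have "t \<in> T s"
      unfolding T_def using t strongly_divisible_imp_dvd(1)[OF n monic _ sd]
      by (simp add: in_prime_factors_iff)
    ultimately show "t \<in> (\<Union>s\<in>S. T s)" by blast
  qed
  have "card ?T \<le> card (\<Union>s\<in>S. T s)" using finS finT by (intro card_mono[OF _ sub]) auto
  also have "\<dots> \<le> (\<Sum>s\<in>S. card (T s))" by (rule card_UN_le[OF finS])
  finally have "real (card ?T) \<le> real (\<Sum>s\<in>S. card (T s))" by (rule of_nat_mono)
  then have "real (card ?T) \<le> (\<Sum>s\<in>S. real (card (T s)))" by simp
  also have "\<dots> \<le> (\<Sum>s\<in>S. (2 * real_of_int L / M + 1) * real n ^ \<omega>)"
  proof (rule sum_mono)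
    fix s assume s: "s \<in> S"
    then have s': "squarefree s" "s dvd m" "real s > M" by (auto simp: S_def)
    have "real (card (T s)) \<le> (2 * real_of_int L / real s + 1) * real n ^ card (prime_factors s)"
      unfolding T_def by (rule card_disc_roots_mod_squarefree[OF n monic s'(1) L])
    also have "\<dots> \<le> (2 * real_of_int L / M + 1) * real n ^ \<omega>"
    proof (intro mult_mono)
      show "2 * real_of_int L / real s + 1 \<le> 2 * real_of_int L / M + 1"
        using s' M L by (intro add_mono divide_left_mono) auto
      have "card (prime_factors s) \<le> \<omega>"
        unfolding \<omega>_def using s' m by (intro card_mono dvd_prime_factors) auto
      then show "real n ^ card (prime_factors s) \<le> real n ^ \<omega>" using n by (intro power_increasing) auto
    qed (use M L in auto)
    finally show "real (card (T s)) \<le> (2 * real_of_int L / M + 1) * real n ^ \<omega>" .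
  qed
  also have "\<dots> = real (card S) * ((2 * real_of_int L / M + 1) * real n ^ \<omega>)" by simp
  also have "\<dots> \<le> 2 ^ \<omega> * ((2 * real_of_int L / M + 1) * real n ^ \<omega>)"
    using cS M L by (intro mult_right_mono) auto
  also have "\<dots> = (2 * real_of_int L / M + 1) * (2 * real n) ^ \<omega>" by (simp add: power_mult_distrib)
  finally show ?thesis unfolding \<omega>_def m_def .
qed

subsection \<open>Counting\<close>

text \<open>Used with \<open>j = 1\<close> for the polynomials \<open>h\<close> without constant
  term, and with \<open>j = 2\<close> for those that also lack the linear term.\<close>

definition monic_box :: "nat \<Rightarrow> nat \<Rightarrow> real \<Rightarrow> int poly set" where
  "monic_box n j X = {f. degree f = n \<and> lead_coeff f = 1 \<and> (\<forall>k<j. coeff f k = 0) \<and>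
     (\<forall>k\<in>{j..<n}. \<bar>real_of_int (coeff f k)\<bar> \<le> X ^ (n - k))}"

text \<open>The free coefficients have weights \<open>1, ..., n - j\<close>, which add up to the
  exponent; each range has at most \<open>3 * X ^ (n - k)\<close> integers.\<close>

lemma card_monic_box:
  assumes X: "X \<ge> 1" and j: "j \<le> n"
  shows "finite (monic_box n j X)"
    and "real (card (monic_box n j X)) \<le> 3 ^ n * X powr (real (n - j) * (real (n - j) + 1) / 2)"
proof -
  define L where "L k = \<lfloor>X ^ (n - k)\<rfloor>" for k
  define P where "P = PiE {j..<n} (\<lambda>k. {- L k..L k})"
  have finP: "finite P" unfolding P_def by (intro finite_PiE) auto
  let ?c = "\<lambda>f. restrict (coeff f) {j..<n}"
  have inj: "inj_on ?c (monic_box n j X)"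
  proof (rule inj_onI)
    fix f g assume f: "f \<in> monic_box n j X" and g: "g \<in> monic_box n j X" and eq: "?c f = ?c g"
    show "f = g"
    proof (rule poly_eqI)
      fix k
      consider "k < j" | "k \<in> {j..<n}" | "k = n" | "k > n" using j by fastforce
      then show "coeff f k = coeff g k"
      proof cases
        case 2
        then show ?thesis using fun_cong[OF eq, of k] by simp
      qed (use f g in \<open>auto simp: monic_box_def coeff_eq_0\<close>)
    qed
  qed
  have "coeff f k \<in> {- L k..L k}" if "f \<in> monic_box n j X" "k \<in> {j..<n}" for f k
  proof -
    have "\<bar>real_of_int (coeff f k)\<bar> \<le> X ^ (n - k)" using that by (simp add: monic_box_def)
    then have "real_of_int (coeff f k) \<le> X ^ (n - k)" "real_of_int (- coeff f k) \<le> X ^ (n - k)" by auto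
    then show ?thesis unfolding L_def le_floor_iff[symmetric] by auto
  qed
  then have sub: "?c ` monic_box n j X \<subseteq> P" unfolding P_def by (intro image_subsetI PiE_I) auto
  show "finite (monic_box n j X)" using inj_on_finite[OF inj sub finP] .
  have "card (monic_box n j X) \<le> card P" by (rule card_inj_on_le[OF inj sub finP])
  also have "card P = (\<Prod>k\<in>{j..<n}. card {- L k..L k})" unfolding P_def by (rule card_PiE) simp
  finally have "real (card (monic_box n j X)) \<le> (\<Prod>k\<in>{j..<n}. real (card {- L k..L k}))"
    by (metis of_nat_le_iff of_nat_prod)
  also have "\<dots> \<le> (\<Prod>k\<in>{j..<n}. 3 * X ^ (n - k))"
  proof (rule prod_mono, safe)
    fix k
    have "1 \<le> X ^ (n - k)" using X by simp
    moreover have "real_of_int (L k) \<le> X ^ (n - k)" "L k \<ge> 1"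
      using \<open>1 \<le> X ^ (n - k)\<close> by (auto simp: L_def)
    ultimately show "real (card {- L k..L k}) \<le> 3 * X ^ (n - k)" by simp
  qed auto
  also have "\<dots> = 3 ^ (n - j) * X ^ (\<Sum>k\<in>{j..<n}. n - k)"
    by (simp add: prod.distrib power_sum)
  also have "(\<Sum>k\<in>{j..<n}. n - k) = (\<Sum>i\<in>{1..n-j}. i)"
    by (rule sum.reindex_bij_witness[of _ "\<lambda>i. n - i" "\<lambda>k. n - k"]) auto
  also have "X ^ (\<Sum>i\<in>{1..n-j}. i) = X powr (real (n - j) * (real (n - j) + 1) / 2)"
  proof -
    define m where "m = n - j"
    define S where "S = (\<Sum>i\<in>{1..m}. i)"
    have "2 * S = m * (m + 1)" unfolding S_def by (induction m) auto
    then have "real (2 * S) = real (m * (m + 1))" by (simp only:)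
    then have S: "real S = real m * (real m + 1) / 2" by (simp add: algebra_simps)
    have "X ^ S = X powr (real m * (real m + 1) / 2)"
      unfolding S[symmetric] using X by (simp add: powr_realpow)
    then show ?thesis by (simp only: m_def S_def)
  qed
  also have "3 ^ (n - j) * X powr (real (n - j) * (real (n - j) + 1) / 2)
      \<le> 3 ^ n * X powr (real (n - j) * (real (n - j) + 1) / 2)"
    by (intro mult_right_mono power_increasing) auto
  finally show "real (card (monic_box n j X)) \<le> 3 ^ n * X powr (real (n - j) * (real (n - j) + 1) / 2)" .
qed

section \<open>Powers with the number of prime factors as exponent\<close>

lemma ln_3_gt_1: "ln (3::real) > 1"
proof -
  \<comment> \<open>The inequality \<open>1 + x \<le> exp x\<close> at \<open>x = - 1 / 6\<close>
    gives \<open>exp 1 \<le> (6 / 5) ^ 6 < 3\<close>.\<close>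
  have "(5/6 :: real) ^ 6 \<le> exp (- 1 / 6) ^ 6"
    using exp_ge_add_one_self[of "-1/6 :: real"] by (intro power_mono) auto
  also have "exp (- 1 / 6 :: real) ^ 6 = exp (- 1)" by (simp flip: exp_of_nat_mult)
  finally have "exp 1 < (3::real)" by (simp add: exp_minus field_simps power_def)
  then show ?thesis by (metis exp_less_cancel_iff exp_ln zero_less_numeral)
qed

text \<open>The splitting point \<open>z = sqrt (ln X)\<close> makes both terms of
  \<open>card_prime_factors_le\<close> at most a constant times
  \<open>ln X / ln (ln X)\<close>.\<close>

lemma power_card_prime_factors_bound:
  assumes A: "A \<ge> 1" and b: "b \<ge> (1::real)"
  shows "\<exists>c>0. \<forall>X\<ge>3. \<forall>m. m > 0 \<longrightarrow> real m \<le> A * X ^ K \<longrightarrow>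
    b ^ card (prime_factors m) \<le> X powr (c / ln (ln X))"
proof -
  \<comment> \<open>The 2 comes from \<open>sqrt Y \<le> 2 * Y / ln Y\<close>, the rest from
    \<open>ln m / ln (sqrt Y)\<close>, where \<open>ln (sqrt Y)\<close> is half of
    \<open>ln Y\<close>.\<close>
  define c where "c = 2 + 2 * (ln A + real K)"
  have c: "c \<ge> 2" using A by (simp add: c_def)
  have "b ^ card (prime_factors m) \<le> X powr ((c * ln b + 1) / ln (ln X))"
    if X: "X \<ge> 3" and m: "m > 0" "real m \<le> A * X ^ K" for X m
  proof -
    define Y where "Y = ln X"
    have "Y \<ge> ln 3" unfolding Y_def using X by simp
    then have Y: "Y > 1" using ln_3_gt_1 by linarith
    then have lY: "ln Y > 0" by simp
    have "ln (sqrt Y) \<le> sqrt Y" using Y ln_le_minus_one[of "sqrt Y"] by simp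
    then have "ln Y \<le> 2 * sqrt Y" using Y by (simp add: ln_sqrt)
    then have "sqrt Y * ln Y \<le> sqrt Y * (2 * sqrt Y)" using Y by (intro mult_left_mono) auto
    also have "\<dots> = 2 * Y" using Y by simp
    finally have 1: "sqrt Y \<le> 2 * Y / ln Y" using lY by (simp add: field_simps)
    have "ln (real m) \<le> ln (A * X ^ K)" using m A X by (subst ln_le_cancel_iff) auto
    also have "\<dots> = ln A + real K * Y" using A X by (simp add: ln_mult ln_realpow Y_def)
    also have "\<dots> \<le> ln A * Y + real K * Y" using A Y by (intro add_mono) (auto simp: mult_le_cancel_left1)
    finally have lm: "ln (real m) \<le> (ln A + real K) * Y" by (simp add: algebra_simps)
    have "real (card (prime_factors m)) \<le> sqrt Y + ln m / ln (sqrt Y)"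
      by (rule card_prime_factors_le) (use m Y in auto)
    also have "\<dots> \<le> 2 * Y / ln Y + 2 * ((ln A + real K) * Y) / ln Y"
    proof (rule add_mono[OF 1])
      have "ln m / ln (sqrt Y) = 2 * ln m / ln Y" using Y by (simp add: ln_sqrt)
      also have "\<dots> \<le> 2 * ((ln A + real K) * Y) / ln Y" using lm lY by (intro divide_right_mono) auto
      finally show "ln m / ln (sqrt Y) \<le> 2 * ((ln A + real K) * Y) / ln Y" .
    qed
    also have "\<dots> = c * Y / ln Y" by (simp add: c_def add_divide_distrib algebra_simps)
    finally have w: "real (card (prime_factors m)) \<le> c * Y / ln Y" .
    have "b ^ card (prime_factors m) = exp (real (card (prime_factors m)) * ln b)"
      using b by (simp add: exp_of_nat_mult)
    also have "\<dots> \<le> exp (c * Y / ln Y * ln b)"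
      unfolding exp_le_cancel_iff using w b by (intro mult_right_mono) auto
    also have "\<dots> \<le> exp ((c * ln b + 1) / ln Y * Y)"
      using Y lY by (simp add: field_simps)
    also have "\<dots> = X powr ((c * ln b + 1) / ln (ln X))" using X by (simp add: powr_def Y_def)
    finally show ?thesis .
  qed
  \<comment> \<open>The summand 1 keeps the exponent positive when \<open>b = 1\<close>.\<close>
  moreover have "c * ln b + 1 > 0" using c b by (simp add: add_nonneg_pos)
  ultimately show ?thesis by blast
qed

lemma disc_disc_const_power:
  "disc_disc_const n (X ^ n) = disc_disc_const n 1 * X ^ (n * ((2*n-1) * (2*n-3)))"
  by (simp add: disc_disc_const_def power_mult_distrib power_mult mult_ac)

section \<open>From the height bound to coefficient boxes\<close>

lemma monicI:
  fixes p :: "'a::zero_neq_one poly"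
  assumes "coeff p n = 1" "\<And>k. k > n \<Longrightarrow> coeff p k = 0"
  shows "degree p = n" "lead_coeff p = 1"
proof -
  show d: "degree p = n"
    by (rule antisym[OF degree_le le_degree]) (use assms in auto)
  show "lead_coeff p = 1" using assms d by simp
qed

lemma height_coeff_le:
  assumes "height f \<le> X" "k < degree f"
  shows "\<bar>real_of_int (coeff f k)\<bar> \<le> X ^ (degree f - k)"
proof -
  define i where "i = degree f - k"
  have i: "i \<in> {1..degree f}" "degree f - i = k" using assms(2) by (auto simp: i_def)
  have r: "root i \<bar>real_of_int (coeff f k)\<bar> \<le> X"
    using assms i by (auto simp: height_le_iff)
  have "\<bar>real_of_int (coeff f k)\<bar> = root i \<bar>real_of_int (coeff f k)\<bar> ^ i" using i by simp
  also have "\<dots> \<le> X ^ i" using r by (intro power_mono real_root_ge_zero) auto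
  finally show ?thesis by (simp add: i_def)
qed

lemma height_imp_monic_box:
  assumes f: "degree f = n" "lead_coeff f = 1" "height f \<le> X"
  shows "1 \<le> n \<Longrightarrow> f - [:coeff f 0:] \<in> monic_box n 1 X"
    and "2 \<le> n \<Longrightarrow> f - [:coeff f 0, coeff f 1:] \<in> monic_box n 2 X"
    and "1 \<le> n \<Longrightarrow> coeff f 0 \<in> {- \<lfloor>X ^ n\<rfloor>..\<lfloor>X ^ n\<rfloor>}"
proof -
  have b: "\<bar>real_of_int (coeff f k)\<bar> \<le> X ^ (n - k)" if "k < n" for k
    using height_coeff_le[of f X k] that f by simp
  have z: "coeff f k = 0" if "k > n" for k using that f by (simp add: coeff_eq_0)
  have o: "coeff f n = 1" using f by simp
  show "f - [:coeff f 0:] \<in> monic_box n 1 X" if "1 \<le> n"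
  proof -
    have "degree (f - [:coeff f 0:]) = n" "lead_coeff (f - [:coeff f 0:]) = 1"
      by (rule monicI; use z o that in \<open>auto simp: coeff_pCons split: nat.splits\<close>)+
    then show ?thesis using b that by (auto simp: monic_box_def coeff_pCons split: nat.splits)
  qed
  show "f - [:coeff f 0, coeff f 1:] \<in> monic_box n 2 X" if "2 \<le> n"
  proof -
    have "degree (f - [:coeff f 0, coeff f 1:]) = n" "lead_coeff (f - [:coeff f 0, coeff f 1:]) = 1"
      by (rule monicI; use z o that in \<open>auto simp: coeff_pCons split: nat.splits\<close>)+
    then show ?thesis using b that
      by (auto simp: monic_box_def coeff_pCons less_Suc_eq numeral_2_eq_2 split: nat.splits)
  qed
  show "coeff f 0 \<in> {- \<lfloor>X ^ n\<rfloor>..\<lfloor>X ^ n\<rfloor>}" if "1 \<le> n"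
  proof -
    have "real_of_int (coeff f 0) \<le> X ^ n" "real_of_int (- coeff f 0) \<le> X ^ n" using b[of 0] that by auto
    then show ?thesis unfolding le_floor_iff[symmetric] by auto
  qed
qed

lemma card_UN_le_mult:
  assumes "finite A" "\<And>a. a \<in> A \<Longrightarrow> real (card (B a)) \<le> c"
  shows "real (card (\<Union>a\<in>A. B a)) \<le> real (card A) * c"
proof -
  have "real (card (\<Union>a\<in>A. B a)) \<le> real (\<Sum>a\<in>A. card (B a))"
    by (rule of_nat_mono[OF card_UN_le[OF assms(1)]])
  also have "\<dots> \<le> (\<Sum>a\<in>A. c)" unfolding of_nat_sum by (rule sum_mono) (rule assms(2))
  finally show ?thesis by simp
qed

theorem theorem3:
  fixes n :: nat
  assumes "n \<ge> 2"
  shows "\<exists>C C' :: real. C > 0 \<and> C' > 0 \<and>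
    (\<forall>X M :: real. X \<ge> 3 \<longrightarrow> M > 0 \<longrightarrow>
       real (card (\<Union>s \<in> {s :: nat. real s > M \<and> squarefree s}. {f \<in> W1 n s. height f \<le> X}))
         \<le> C * (X powr (real n * (real n + 1) / 2 + C' / ln (ln X)) / M
                + X powr (real n * (real n + 1) / 2 + C' / ln (ln X) - (real n - 1))))"
proof -
  \<comment> \<open>The exponent of \<open>X\<close> in the bound for \<open>disc_disc h\<close>
    when all coefficients are at most \<open>X ^ n\<close>.\<close>
  define K where "K = n * ((2*n-1) * (2*n-3))"
  define A where "A = max 1 (disc_disc_const n 1)"
  obtain c where c: "c > 0" and omega: "\<And>X m. X \<ge> 3 \<Longrightarrow> m > 0 \<Longrightarrow> real m \<le> A * X ^ K \<Longrightarrow>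
    (2 * real n) ^ card (prime_factors m) \<le> X powr (c / ln (ln X))"
    using power_card_prime_factors_bound[of A "2 * real n" K] assms unfolding A_def by auto
  \<comment> \<open>Bounds the number of degenerate linear coefficients for each choice of the
    higher ones.\<close>
  define K2 where "K2 = 1 + disc_disc_const n (2 ^ n)"
  have K2: "K2 \<ge> 1" by (simp add: K2_def disc_disc_const_def)
  define C where "C = 3 ^ n * (3 + 3 * K2)"
  have "real (card (\<Union>s \<in> {s :: nat. real s > M \<and> squarefree s}. {f \<in> W1 n s. height f \<le> X}))
      \<le> C * (X powr (real n * (real n + 1) / 2 + c / ln (ln X)) / M
             + X powr (real n * (real n + 1) / 2 + c / ln (ln X) - (real n - 1)))"
    (is "real (card ?U) \<le> _") if X: "X \<ge> 3" and M: "M > 0" for X M :: real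
  proof -
    define E where "E = c / ln (ln X)"
    \<comment> \<open>Up to a constant, \<open>X powr a\<close> bounds the number of
      \<open>h\<close>. The two exponents of the goal are \<open>a + n\<close> and
      \<open>a + 1\<close>, each increased by \<open>E\<close>.\<close>
    define a where "a = real n * (real n - 1) / 2"
    define L where "L = \<lfloor>X ^ n\<rfloor>"
    have "ln X \<ge> ln 3" using X by simp
    then have "ln X > 1" using ln_3_gt_1 by linarith
    then have E: "E > 0" using c by (simp add: E_def)
    have Xn: "X ^ n \<ge> 1" using X by simp
    have L: "L \<ge> 0" "real_of_int L \<le> X ^ n" using Xn by (auto simp: L_def)
    define T where "T h = {t \<in> {-L..L}. \<exists>s. real s > M \<and> squarefree s \<and>
      (\<forall>p. prime p \<longrightarrow> p dvd s \<longrightarrow> strongly_divisible p (h + [:t:]))}" for h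
    have finT: "finite (T h)" for h unfolding T_def by (rule finite_subset[of _ "{-L..L}"]) auto
    \<comment> \<open>The set is split by the vanishing of the second discriminant:
      \<open>U1\<close> covers the generic \<open>h\<close>, \<open>U2\<close> the degenerate
      ones.\<close>
    define G where "G = {h \<in> monic_box n 1 X. disc_disc h \<noteq> 0}"
    define U1 where "U1 = (\<Union>h\<in>G. (\<lambda>t. h + [:t:]) ` T h)"
    define Y :: "int poly \<Rightarrow> int set" where "Y g = {y. disc_disc (g + [:0, y:]) = 0}" for g
    define U2 where "U2 = (\<Union>g\<in>monic_box n 2 X. \<Union>y\<in>Y g. (\<lambda>t. g + [:t, y:]) ` {-L..L})"
    have box1: "finite (monic_box n 1 X)" "real (card (monic_box n 1 X)) \<le> 3 ^ n * X powr a"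
      using card_monic_box[of X 1 n] X assms by (auto simp: a_def of_nat_diff mult.commute)
    have box2: "finite (monic_box n 2 X)"
        "real (card (monic_box n 2 X)) \<le> 3 ^ n * X powr ((real n - 2) * (real n - 1) / 2)"
      using card_monic_box[of X 2 n] X assms by (auto simp: of_nat_diff)
    have finG: "finite G" using box1 by (auto simp: G_def)
    have cG: "real (card G) \<le> 3 ^ n * X powr a"
    proof -
      have "card G \<le> card (monic_box n 1 X)" using box1 by (intro card_mono) (auto simp: G_def)
      then show ?thesis using box1(2) by linarith
    qed
    have Y: "finite (Y g)" "real (card (Y g)) \<le> K2" if "g \<in> monic_box n 2 X" for g
      using card_disc_disc_zero[of n g] that assms by (auto simp: Y_def K2_def monic_box_def)
    have "?U \<subseteq> U1 \<union> U2"
    proof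
      fix f assume "f \<in> ?U"
      then obtain s where s: "real s > M" "squarefree s" and f: "f \<in> W1 n s" "height f \<le> X" by blast
      have f': "degree f = n" "lead_coeff f = 1"
        and sd: "\<And>p. prime p \<Longrightarrow> p dvd s \<Longrightarrow> strongly_divisible p f"
        using f(1) by (auto simp: W1_def)
      note mb = height_imp_monic_box[OF f' f(2)]
      define h where "h = f - [:coeff f 0:]"
      define g where "g = f - [:coeff f 0, coeff f 1:]"
      have fh: "f = h + [:coeff f 0:]" by (simp add: h_def)
      have fg: "f = g + [:coeff f 0, coeff f 1:]" by (simp add: g_def)
      have hg: "h = g + [:0, coeff f 1:]" by (simp add: h_def g_def)
      have t: "coeff f 0 \<in> {-L..L}" using mb(3) assms by (simp add: L_def)
      show "f \<in> U1 \<union> U2"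
      proof (cases "disc_disc h = 0")
        case True
        then have "coeff f 1 \<in> Y g" by (simp add: Y_def hg)
        moreover have "g \<in> monic_box n 2 X" using mb(2) assms by (simp add: g_def)
        ultimately show ?thesis using t fg unfolding U2_def by blast
      next
        case False
        then have "h \<in> G" using mb(1) assms by (simp add: G_def h_def)
        moreover have "coeff f 0 \<in> T h"
          unfolding T_def using t s sd fh[symmetric] by auto
        ultimately show ?thesis using fh unfolding U1_def by blast
      qed
    qed
    moreover have "finite U1" "finite U2"
      using finG finT box2 Y by (auto simp: U1_def U2_def)
    ultimately have "card ?U \<le> card (U1 \<union> U2)" by (intro card_mono) auto
    also have "\<dots> \<le> card U1 + card U2" by (rule card_Un_le)
    finally have cU: "real (card ?U) \<le> real (card U1) + real (card U2)" by linarith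
    have "real (card U1) \<le> real (card G) * ((2 * X ^ n / M + 1) * X powr E)"
      unfolding U1_def
    proof (rule card_UN_le_mult[OF finG])
      fix h assume "h \<in> G"
      then have h: "degree h = n" "lead_coeff h = 1" "disc_disc h \<noteq> 0"
        and hb: "h \<in> monic_box n 1 X" by (auto simp: G_def monic_box_def)
      let ?m = "nat \<bar>disc_disc h\<bar>"
      have "\<bar>real_of_int (coeff h i)\<bar> \<le> X ^ n" for i
      proof -
        consider "i = 0" | "i \<in> {1..<n}" | "i = n" | "i > n" by fastforce
        then show ?thesis
        proof cases
          case 2
          then have "\<bar>real_of_int (coeff h i)\<bar> \<le> X ^ (n - i)" using hb by (simp add: monic_box_def)
          also have "\<dots> \<le> X ^ n" using X by (intro power_increasing) auto
          finally show ?thesis .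
        qed (use hb Xn in \<open>auto simp: monic_box_def coeff_eq_0\<close>)
      qed
      then have "\<bar>real_of_int (disc_disc h)\<bar> \<le> disc_disc_const n (X ^ n)"
        using disc_disc_bound[OF ring_norm_abs h(1) _ h(2) Xn] assms by (simp add: disc_disc_const_def)
      also have "\<dots> \<le> A * X ^ K"
        unfolding disc_disc_const_power K_def A_def using X by (intro mult_right_mono) auto
      finally have "real ?m \<le> A * X ^ K" by simp
      then have w: "(2 * real n) ^ card (prime_factors ?m) \<le> X powr E"
        unfolding E_def by (rule omega[OF X, rotated]) (use h in simp)
      have "card ((\<lambda>t. h + [:t:]) ` T h) \<le> card (T h)" by (rule card_image_le[OF finT])
      then have "real (card ((\<lambda>t. h + [:t:]) ` T h)) \<le> real (card (T h))" by simp
      also have "\<dots> \<le> (2 * real_of_int L / M + 1) * (2 * real n) ^ card (prime_factors ?m)"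
        unfolding T_def by (rule card_strongly_divisible_shifts[OF h(1) assms h(2,3) L(1) M])
      also have "\<dots> \<le> (2 * X ^ n / M + 1) * X powr E"
        using w L M X by (intro mult_mono add_mono divide_right_mono) auto
      finally show "real (card ((\<lambda>t. h + [:t:]) ` T h)) \<le> (2 * X ^ n / M + 1) * X powr E" .
    qed
    also have "\<dots> \<le> (3 ^ n * X powr a) * ((2 * X ^ n / M + 1) * X powr E)"
      using cG M X by (intro mult_right_mono) auto
    also have "\<dots> = 3 ^ n * (2 * (X powr (a + real n + E) / M) + X powr (a + E))"
      using X by (simp add: powr_add powr_realpow algebra_simps)
    \<comment> \<open>The generic part even allows \<open>a + E\<close>; raising it to
      \<open>a + 1 + E\<close> matches the exponent of the degenerate part.\<close>
    also have "\<dots> \<le> 3 ^ n * (2 * (X powr (a + real n + E) / M) + X powr (a + 1 + E))"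
      using X by (intro mult_left_mono add_left_mono powr_mono) auto
    finally have c1: "real (card U1) \<le> 3 ^ n * (2 * (X powr (a + real n + E) / M) + X powr (a + 1 + E))" .
    have "real (card U2) \<le> real (card (monic_box n 2 X)) * (K2 * (3 * X ^ n))"
      unfolding U2_def
    proof (rule card_UN_le_mult[OF box2(1)])
      fix g assume g: "g \<in> monic_box n 2 X"
      have "real (card (\<Union>y\<in>Y g. (\<lambda>t. g + [:t, y:]) ` {-L..L})) \<le> real (card (Y g)) * (3 * X ^ n)"
      proof (rule card_UN_le_mult[OF Y(1)[OF g]])
        fix y
        have "card ((\<lambda>t. g + [:t, y:]) ` {-L..L}) \<le> card {-L..L}" by (rule card_image_le) simp
        then have "real (card ((\<lambda>t. g + [:t, y:]) ` {-L..L})) \<le> real (card {-L..L})" by simp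
        also have "\<dots> \<le> 3 * X ^ n" using L Xn by simp
        finally show "real (card ((\<lambda>t. g + [:t, y:]) ` {-L..L})) \<le> 3 * X ^ n" .
      qed
      also have "\<dots> \<le> K2 * (3 * X ^ n)" using Y(2)[OF g] Xn by (intro mult_right_mono) auto
      finally show "real (card (\<Union>y\<in>Y g. (\<lambda>t. g + [:t, y:]) ` {-L..L})) \<le> K2 * (3 * X ^ n)" .
    qed
    also have "\<dots> \<le> (3 ^ n * X powr ((real n - 2) * (real n - 1) / 2)) * (K2 * (3 * X ^ n))"
      using box2(2) K2 Xn by (intro mult_right_mono) auto
    also have "\<dots> = 3 ^ n * (3 * K2 * (X powr ((real n - 2) * (real n - 1) / 2) * X powr real n))"
      using X by (simp add: powr_realpow)
    \<comment> \<open>A bounded number of choices for the linear coefficient, instead of about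
      \<open>X ^ (n - 1)\<close>, is what produces the saving \<open>n - 1\<close> in the second
      term.\<close>
    also have "X powr ((real n - 2) * (real n - 1) / 2) * X powr real n = X powr (a + 1)"
      unfolding powr_add[symmetric] a_def by (simp add: field_simps)
    also have "3 ^ n * (3 * K2 * X powr (a + 1)) \<le> 3 ^ n * (3 * K2 * X powr (a + 1 + E))"
      using X E K2 by (intro mult_left_mono powr_mono) auto
    finally have c2: "real (card U2) \<le> 3 ^ n * (3 * K2 * X powr (a + 1 + E))" .
    define P where "P = X powr (a + real n + E) / M"
    define Q where "Q = X powr (a + 1 + E)"
    have PQ: "P \<ge> 0" "Q \<ge> 0" using M by (auto simp: P_def Q_def)
    have "real (card ?U) \<le> 3 ^ n * (2 * P + Q + 3 * K2 * Q)"
      using cU c1 c2 by (simp add: P_def Q_def algebra_simps)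
    also have "\<dots> \<le> 3 ^ n * ((3 + 3 * K2) * (P + Q))"
      using PQ K2 by (intro mult_left_mono) (auto simp: algebra_simps intro: add_nonneg_nonneg)
    also have "\<dots> = C * (P + Q)" by (simp add: C_def)
    also have "P = X powr (real n * (real n + 1) / 2 + E) / M"
      by (simp add: P_def a_def field_simps)
    also have "Q = X powr (real n * (real n + 1) / 2 + E - (real n - 1))"
      by (simp add: Q_def a_def field_simps)
    finally show ?thesis by (simp add: E_def)
  qed
  moreover have "C > 0" using K2 by (simp add: C_def)
  ultimately show ?thesis using c by blast
qed

end
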